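(* Let $1<r\le 2$ and $\frac1r+\frac1s=1$. There is a constant $C=C(r)>0$ such that for every $g\in W^1_{r,per}[-\pi,\pi]$, the function $g$ is an $L_1$-multiplier and $$\|T_{g}\|_{\mathcal{B}(L_1)}\leq |a_0| + C \left\| g \right\|^{\frac{1}{s}}_{L_r[-\pi,\pi]} \left\| g'\right\|^{\frac{1}{r}}_{L_r[-\pi,\pi]},$$ where $a_0=\frac{1}{2 \pi} \int_{-\pi}^{\pi} g(x)\, dx$ is the $0$-th Fourier coefficient of $g$.
   Context: $L_1=L_1(\mathbb R)$ (complex-valued functions), with Fourier transform $\hat f(k)=\int_{-\infty}^\infty e^{ikx}f(x)\,dx$. A measurable function $\psi:\mathbb R\to\mathbb C$ is an $L_1$-multiplier if for every $f\in L_1$ there is $v\in L_1$ with $\psi\hat f=\hat v$; then $T_\psi:L_1\to L_1$ is defined by $T_\psi f:=v$. It is a bounded operator, and $\|\cdot\|_{\mathcal B(L_1)}$ denotes the operator norm on $L_1$. $W^1_{r,per}[-\pi,\pi]$ is the Sobolev space of $2\pi$-periodic functions $g$ on $\mathbb R$ such that both $g$ and its generalized derivative $g'$ belong to $L_r[-\pi,\pi]$. *)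

theory Defs
  imports "HOL-Analysis.Analysis"
begin

text \<open>Elements of \<open>L\<^sub>p\<close> spaces are represented by Lebesgue measurable functions; equality of
  classes is equality almost everywhere.\<close>

definition L1 :: "(real \<Rightarrow> complex) set" where
  "L1 = {f. integrable lebesgue f}"

definition L1_norm :: "(real \<Rightarrow> complex) \<Rightarrow> real" where
  "L1_norm f = (LINT x|lebesgue. norm (f x))"

definition fourier :: "(real \<Rightarrow> complex) \<Rightarrow> real \<Rightarrow> complex" where
  "fourier f k = (LINT x|lebesgue. exp (\<i> * of_real (k * x)) * f x)"

text \<open>The identity \<open>\<psi> * fourier f = fourier v\<close> is one between measurable functions, hence holds
  almost everywhere. Since \<open>fourier v\<close> is continuous, this still determines \<open>v\<close> as an
  element of \<open>L\<^sub>1\<close>.\<close>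

definition multiplier_rel ::
    "(real \<Rightarrow> complex) \<Rightarrow> (real \<Rightarrow> complex) \<Rightarrow> (real \<Rightarrow> complex) \<Rightarrow> bool" where
  "multiplier_rel \<psi> f v \<longleftrightarrow> v \<in> L1 \<and> (AE k in lebesgue. \<psi> k * fourier f k = fourier v k)"

definition L1_multiplier :: "(real \<Rightarrow> complex) \<Rightarrow> bool" where
  "L1_multiplier \<psi> \<longleftrightarrow> \<psi> \<in> borel_measurable lebesgue \<and> (\<forall>f\<in>L1. \<exists>v. multiplier_rel \<psi> f v)"

text \<open>The choice below only selects a representative of a uniquely determined class.\<close>

definition multiplier_op :: "(real \<Rightarrow> complex) \<Rightarrow> (real \<Rightarrow> complex) \<Rightarrow> (real \<Rightarrow> complex)" where
  "multiplier_op \<psi> f = (SOME v. multiplier_rel \<psi> f v)"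

text \<open>The operator norm takes values in \<^typ>\<open>ennreal\<close>, so that it is \<open>\<infinity>\<close> for
  unbounded operators and a finite bound on it asserts boundedness.\<close>

definition L1_opnorm :: "((real \<Rightarrow> complex) \<Rightarrow> (real \<Rightarrow> complex)) \<Rightarrow> ennreal" where
  "L1_opnorm T = (SUP f\<in>{f \<in> L1. L1_norm f \<le> 1}. ennreal (L1_norm (T f)))"

definition Lr_per :: "real \<Rightarrow> (real \<Rightarrow> complex) set" where
  "Lr_per r = {f. f \<in> borel_measurable (lebesgue_on {-pi..pi}) \<and>
                  integrable (lebesgue_on {-pi..pi}) (\<lambda>x. norm (f x) powr r)}"

definition Lr_per_norm :: "real \<Rightarrow> (real \<Rightarrow> complex) \<Rightarrow> real" where
  "Lr_per_norm r f = (LINT x|lebesgue_on {-pi..pi}. norm (f x) powr r) powr (1 / r)"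

definition locally_integrable :: "(real \<Rightarrow> complex) \<Rightarrow> bool" where
  "locally_integrable f \<longleftrightarrow> (\<forall>a b. integrable (lebesgue_on {a..b}) f)"

definition test_function :: "(real \<Rightarrow> real) \<Rightarrow> bool" where
  "test_function \<phi> \<longleftrightarrow> (\<forall>n x. (deriv ^^ n) \<phi> field_differentiable at x) \<and>
                      compact (closure {x. \<phi> x \<noteq> 0})"

definition has_generalized_derivative :: "(real \<Rightarrow> complex) \<Rightarrow> (real \<Rightarrow> complex) \<Rightarrow> bool" where
  "has_generalized_derivative g g' \<longleftrightarrow> locally_integrable g \<and> locally_integrable g' \<and>
     (\<forall>\<phi>. test_function \<phi> \<longrightarrow>
        (LINT x|lebesgue. g x * of_real (deriv \<phi> x)) = - (LINT x|lebesgue. g' x * of_real (\<phi> x)))"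

definition W1_per :: "real \<Rightarrow> (real \<Rightarrow> complex) set" where
  "W1_per r = {g. (\<forall>x. g (x + 2 * pi) = g x) \<and> g \<in> Lr_per r \<and>
                  (\<exists>g'. has_generalized_derivative g g' \<and> g' \<in> Lr_per r)}"

definition fourier_coeff0 :: "(real \<Rightarrow> complex) \<Rightarrow> complex" where
  "fourier_coeff0 g = 1 / (2 * of_real pi) * (LINT x|lebesgue_on {-pi..pi}. g x)"

end

theory Submission
  imports Defs "HOL-Probability.Levy" "HOL-Library.Nat_Bijection"
begin

text \<open>If \<open>g(k) = (\<Sum>n. a\<^sub>n * cis (n * k))\<close> with \<open>\<Sum>n. \<bar>a\<^sub>n\<bar>\<close> finite, then multiplying a Fourier transform by
  \<open>g\<close> amounts to applying \<open>f \<mapsto> (\<Sum>n. a\<^sub>n * f(x - n))\<close>, because translating \<open>f\<close> by \<open>n\<close> multiplies its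
  transform by \<open>cis (n * k)\<close>. Translations are isometries of \<open>L\<^sub>1\<close>, so the multiplier norm is at most
  \<open>\<Sum>n. \<bar>a\<^sub>n\<bar>\<close> (\<open>exponential_sum_multiplier\<close>). The theorem therefore reduces to the estimate
  \<open>(\<Sum>n\<noteq>0. \<bar>a\<^sub>n\<bar>) \<le> C * A powr (1/s) * B powr (1/r)\<close> for the Fourier coefficients of \<open>g\<close>, where
  \<open>A\<close> and \<open>B\<close> are the \<open>L\<^sub>r\<close> norms of \<open>g\<close> and \<open>g'\<close> (\<open>sum_fourier_coeffs_le\<close>).

  The classical route to that estimate is the Hausdorff-Young inequality for \<open>g\<close> and \<open>g'\<close>. The proof
  here needs only Bessel's inequality, in the manner of Bernstein's theorem on absolute convergence.
  The frequencies with \<open>2^j \<le> \<bar>n\<bar> < 2^(j+1)\<close> form a block; for the step \<open>h = pi / 2^(j+1)\<close> the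
  factor \<open>cis (n * h) - 1\<close> is bounded away from \<open>0\<close> on the block, so Cauchy-Schwarz and Bessel for
  \<open>\<Delta> x = g (x + h) - g x\<close> bound the square of the block sum by \<open>2^j * \<integral>\<bar>\<Delta>\<bar>\<^sup>2\<close>. As
  \<open>\<bar>\<Delta>\<bar> \<le> h powr (1/s) * B\<close> pointwise by Hoelder, the exponent \<open>2\<close> is lowered to \<open>r\<close>:
  \<open>\<integral>\<bar>\<Delta>\<bar>\<^sup>2 \<le> (h powr (1/s) * B) powr (2 - r) * \<integral>\<bar>\<Delta>\<bar> powr r\<close>. The last integral is at most
  a constant times \<open>A powr r\<close>, and also at most \<open>(h * B) powr r\<close>. The first bound makes the block sums grow
  geometrically in \<open>j\<close>, the second makes them decay geometrically; using the first
  for \<open>2^j \<le> B / A\<close> and the second beyond that point gives exactly the product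
  \<open>A powr (1/s) * B powr (1/r)\<close>.

  Three facts link this computation to the definitions. A function with a generalized derivative
  \<open>g'\<close> agrees almost everywhere with a continuous primitive of \<open>g'\<close>
  (\<open>weak_derivative_representative\<close>), obtained by testing against smooth approximations of
  trapezoids. A continuous periodic function is the sum of its Fourier series once that series
  converges absolutely (\<open>fourier_series_absolutely_convergent\<close>), by the Stone-Weierstrass theorem on
  the circle. And the Fourier transform is injective on \<open>L\<^sub>1\<close> (\<open>fourier_unique\<close>), by Levy's uniqueness
  theorem, so that the function chosen by \<open>multiplier_op\<close> is the translation series above.\<close>

section \<open>Smooth bump functions\<close>

text \<open>The functions \<open>p(1/x) * exp(-1/x)\<close>, extended by \<open>0\<close> to \<open>x \<le> 0\<close>, form a class that is closed
  under differentiation; admitting all polynomials \<open>p\<close> replaces the usual induction over the order of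
  the derivative.\<close>
definition flat :: "real poly \<Rightarrow> real \<Rightarrow> real" where
  "flat q x = (if x \<le> 0 then 0 else poly q (1 / x) * exp (- (1 / x)))"

lemma poly_div_exp_tendsto_0: "((\<lambda>y::real. poly q y / exp y) \<longlongrightarrow> 0) at_top"
proof -
  have "((\<lambda>y. \<Sum>i\<le>degree q. coeff q i * (y ^ i / exp y)) \<longlongrightarrow> (\<Sum>i\<le>degree q. coeff q i * 0)) at_top"
    by (intro tendsto_intros tendsto_power_div_exp_0)
  then show ?thesis
    by (simp add: poly_altdef sum_divide_distrib)
qed

lemma flat_over_x_tendsto_0: "((\<lambda>x. flat q x / x) \<longlongrightarrow> 0) (at 0)"
proof (rule filterlim_split_at)
  show "((\<lambda>x. flat q x / x) \<longlongrightarrow> 0) (at_left 0)"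
    by (rule Lim_transform_eventually[OF tendsto_const])
       (auto simp: flat_def eventually_at_left_field intro: exI[of _ "-1"])
  have "((\<lambda>x. poly (pCons 0 q) (inverse x) / exp (inverse x)) \<longlongrightarrow> 0) (at_right (0::real))"
    using filterlim_compose[OF poly_div_exp_tendsto_0 filterlim_inverse_at_top_right] .
  then show "((\<lambda>x. flat q x / x) \<longlongrightarrow> 0) (at_right 0)"
    by (rule Lim_transform_eventually)
       (auto simp: flat_def eventually_at_right_field exp_minus field_simps intro: exI[of _ "1"])
qed

lemma flat_has_derivative:
  "(flat q has_field_derivative flat ([:0, 0, 1:] * (q - pderiv q)) x) (at x)"
proof -
  consider "x < 0" | "x = 0" | "x > 0" by linarith
  then show ?thesis
  proof cases
    case 1
    have "((\<lambda>_. 0) has_field_derivative 0) (at x)" by simp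
    then show ?thesis
      using 1 by (rule_tac has_field_derivative_transform_within_open[of "\<lambda>_. 0" _ _ "{..<0}"])
                 (auto simp: flat_def)
  next
    case 2
    then show ?thesis
      using flat_over_x_tendsto_0[of q] by (simp add: has_field_derivative_iff flat_def)
  next
    case 3
    have "((\<lambda>x. poly q (1 / x) * exp (- (1 / x))) has_field_derivative
            flat ([:0, 0, 1:] * (q - pderiv q)) x) (at x)"
      using 3 by (auto intro!: derivative_eq_intros DERIV_chain'[OF _ poly_DERIV] 
            simp: flat_def power2_eq_square field_simps)
    then show ?thesis
      using 3 by (rule_tac has_field_derivative_transform_within_open[where S = "{0<..}"])
                 (auto simp: flat_def)
  qed
qed

text \<open>Closed under differentiation by the product rule; scalar factors are absorbed by the polynomials.
  Hence every member is smooth, and so is every primitive of a member.\<close>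
inductive bump_sum :: "(real \<Rightarrow> real) \<Rightarrow> bool" where
  prod: "bump_sum (\<lambda>x. flat p (k * (x - a)) * flat q (k * (b - x)))"
| add: "bump_sum f \<Longrightarrow> bump_sum g \<Longrightarrow> bump_sum (\<lambda>x. f x + g x)"

lemma flat_smult: "flat (smult c q) x = c * flat q x"
  by (simp add: flat_def)

lemma bump_sum_has_derivative:
  assumes "bump_sum f"
  shows "\<exists>f'. bump_sum f' \<and> (\<forall>x. (f has_field_derivative f' x) (at x))"
  using assms
proof induction
  case (prod p k a q b)
  let ?d = "\<lambda>q. [:0, 0, 1:] * (q - pderiv q)"
  let ?f' = "\<lambda>x. flat (smult k (?d p)) (k * (x - a)) * flat q (k * (b - x))
               + flat p (k * (x - a)) * flat (smult (-k) (?d q)) (k * (b - x))"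
  have "bump_sum ?f'"
    by (intro bump_sum.intros)
  moreover have "((\<lambda>x. flat p (k * (x - a)) * flat q (k * (b - x))) has_field_derivative ?f' x) (at x)" for x
    unfolding flat_smult
    by (rule derivative_eq_intros DERIV_chain'[OF _ flat_has_derivative] refl | simp)+
  ultimately show ?case by blast
next
  case (add f g)
  then obtain f' g' where "bump_sum f'" "\<forall>x. (f has_field_derivative f' x) (at x)"
      "bump_sum g'" "\<forall>x. (g has_field_derivative g' x) (at x)" by blast
  then show ?case
    by (intro exI[of _ "\<lambda>x. f' x + g' x"]) (auto intro: bump_sum.add DERIV_add)
qed

lemma smooth_of_bump_sum_deriv:
  assumes "\<And>x. (\<phi> has_field_derivative \<zeta> x) (at x)" and "bump_sum \<zeta>"
  shows "(deriv ^^ n) \<phi> field_differentiable at x"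
proof -
  have *: "bump_sum f \<Longrightarrow> bump_sum (deriv f)" for f
    by (metis (no_types, lifting) DERIV_imp_deriv bump_sum_has_derivative ext)
  have "deriv \<phi> = \<zeta>"
    using assms(1) DERIV_imp_deriv by blast
  have "bump_sum ((deriv ^^ Suc n) \<phi>)" for n
  proof (induction n)
    case 0
    then show ?case using assms(2) \<open>deriv \<phi> = \<zeta>\<close> by simp
  next
    case (Suc n)
    then show ?case using * by simp
  qed
  then show ?thesis
    using assms(1) bump_sum_has_derivative field_differentiable_def
    by (metis funpow_0 not0_implies_Suc)
qed

text \<open>For \<open>k \<rightarrow> \<infinity>\<close> these increase to the indicator of \<open>{a<..<b}\<close>, because \<open>exp (- 1 / (k * y)) \<rightarrow> 1\<close> for
  \<open>y > 0\<close>; being bounded by \<open>1\<close>, they may replace the indicator under an integral.\<close>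

definition bump :: "nat \<Rightarrow> real \<Rightarrow> real \<Rightarrow> real \<Rightarrow> real" where
  "bump k a b x = flat 1 (real k * (x - a)) * flat 1 (real k * (b - x))"

lemma bump_bounds: "0 \<le> bump k a b x" "bump k a b x \<le> 1"
  by (auto simp: bump_def flat_def intro!: mult_le_one)

lemma bump_outside: "x \<notin> {a<..<b} \<Longrightarrow> bump k a b x = 0"
  by (auto simp: bump_def flat_def mult_le_0_iff)

lemma bump_tendsto: "(\<lambda>k. bump k a b x) \<longlonglongrightarrow> indicator {a<..<b} x"
proof (cases "x \<in> {a<..<b}")
  case True
  have *: "(\<lambda>k. flat 1 (real k * y)) \<longlonglongrightarrow> 1" if "y > 0" for y
  proof (rule Lim_transform_eventually)
    have "(\<lambda>k. exp (- (inverse (real k) * (1 / y)))) \<longlonglongrightarrow> exp (- (0 * (1 / y)))"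
      by (intro tendsto_intros lim_inverse_n)
    then show "(\<lambda>k. exp (- (inverse (real k) * (1 / y)))) \<longlonglongrightarrow> 1" by simp
    show "\<forall>\<^sub>F k in sequentially. exp (- (inverse (real k) * (1 / y))) = flat 1 (real k * y)"
      using eventually_gt_at_top[of 0] by eventually_elim (use that in \<open>auto simp: flat_def field_simps mult_le_0_iff\<close>)
  qed
  have "(\<lambda>k. bump k a b x) \<longlonglongrightarrow> 1 * 1"
    unfolding bump_def using True by (intro tendsto_mult *) auto
  then show ?thesis using True by simp
qed (simp add: bump_outside)

lemma bump_translate: "bump k (a + c) (b + c) (x + c) = bump k a b x"
  by (simp add: bump_def algebra_simps)

lemma continuous_on_bump: "continuous_on S (bump k a b)"
proof -
  have "bump_sum (bump k a b)" unfolding bump_def [abs_def] by (rule bump_sum.prod)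
  then show ?thesis
    by (meson DERIV_continuous bump_sum_has_derivative continuous_at_imp_continuous_on)
qed

section \<open>Weak derivatives\<close>

lemma locally_integrable_absolutely:
  assumes "locally_integrable g" shows "g absolutely_integrable_on {a..b}"
proof -
  have "integrable (lebesgue_on {a..b}) g"
    using assms by (simp add: locally_integrable_def)
  then show ?thesis
    by (simp add: absolutely_integrable_measurable o_def borel_measurable_integrable integrable_norm)
qed

lemma absolutely_integrable_scaleR_bounded:
  fixes g :: "real \<Rightarrow> complex" and f :: "real \<Rightarrow> real"
  assumes "g absolutely_integrable_on {a..b}" "f \<in> borel_measurable (lebesgue_on {a..b})"
    "\<And>x. x \<in> {a..b} \<Longrightarrow> \<bar>f x\<bar> \<le> K"
  shows "(\<lambda>x. f x *\<^sub>R g x) absolutely_integrable_on {a..b}"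
  by (rule absolutely_integrable_bounded_measurable_product[where h = "(*\<^sub>R)"])
     (use assms in \<open>auto simp: bilinear_conv_bounded_bilinear bounded_bilinear_scaleR bounded_iff intro!: exI[of _ K]\<close>)

lemma lebesgue_integral_supported:
  fixes h :: "real \<Rightarrow> complex"
  assumes "h absolutely_integrable_on {a..b}" "\<And>x. x \<notin> {a..b} \<Longrightarrow> h x = 0"
  shows "(LINT x|lebesgue. h x) = integral {a..b} h"
proof -
  have "(\<lambda>x. if x \<in> {a..b} then h x else 0) = h"
    using assms(2) by auto
  then have "(LINT x|lebesgue. h x) = (LINT x|lebesgue_on {a..b}. h x)"
    using Lebesgue_Measure.integral_restrict_UNIV[of "{a..b}" h] by simp
  also have "\<dots> = integral {a..b} h"
    using assms(1) by (intro lebesgue_integral_eq_integral absolutely_integrable_imp_integrable) auto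
  finally show ?thesis .
qed

text \<open>The mean value zero makes the primitive vanish to the right of the support as well, so it is an
  admissible test function whose derivative is the prescribed \<open>\<zeta>\<close>.\<close>
lemma bump_primitive:
  fixes \<zeta> :: "real \<Rightarrow> real"
  assumes \<zeta>: "bump_sum \<zeta>" and supp: "\<And>x. x \<notin> {a<..<c} \<Longrightarrow> \<zeta> x = 0" and "a \<le> c"
    and mean: "integral {a..c} \<zeta> = 0"
  defines "\<phi> \<equiv> \<lambda>x. integral {a..x} \<zeta>"
  shows "test_function \<phi>" "deriv \<phi> = \<zeta>" "\<And>x. x \<notin> {a..c} \<Longrightarrow> \<phi> x = 0"
proof -
  have cont: "continuous_on S \<zeta>" for S
    by (meson DERIV_continuous \<zeta> bump_sum_has_derivative continuous_at_imp_continuous_on)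
  then have int: "\<zeta> integrable_on {u..v}" for u v
    by (rule integrable_continuous_real)
  have \<phi>_left: "\<phi> x = 0" if "x \<le> a" for x
    using that by (cases "x = a") (auto simp: \<phi>_def)
  \<comment> \<open>Starting the integral at \<open>a - 1\<close> makes \<open>a\<close> an interior point, where it can be differentiated.\<close>
  have \<phi>_eq: "\<phi> x = integral {a-1..x} \<zeta>" for x
  proof (cases "a \<le> x")
    case True
    have "integral {a-1..a} \<zeta> = integral {a-1..a} (\<lambda>x. 0::real)"
      by (intro integral_cong) (use supp in auto)
    then show ?thesis
      using True Henstock_Kurzweil_Integration.integral_combine[OF _ True int, of "a-1"] by (simp add: \<phi>_def)
  next
    case False
    have "integral {a-1..x} \<zeta> = integral {a-1..x} (\<lambda>x. 0::real)"
      by (intro integral_cong) (use supp False in auto)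
    then show ?thesis
      using \<phi>_left False by simp
  qed
  have der: "(\<phi> has_field_derivative \<zeta> x) (at x)" for x
  proof (cases "x < a")
    case True
    have "((\<lambda>_. 0) has_field_derivative \<zeta> x) (at x)" using True supp by simp
    then show ?thesis
      by (rule has_field_derivative_transform_within_open[where S = "{..<a}"])
         (use True \<phi>_left in auto)
  next
    case False
    have "((\<lambda>u. integral {a-1..u} \<zeta>) has_real_derivative \<zeta> x) (at x within {a-1..x+1})"
      by (rule integral_has_real_derivative) (use False cont in auto)
    then have "((\<lambda>u. integral {a-1..u} \<zeta>) has_real_derivative \<zeta> x) (at x)"
      using False by (simp add: at_within_Icc_at)
    then show ?thesis
      using \<phi>_eq by presburger
  qed
  then show d: "deriv \<phi> = \<zeta>"
    using DERIV_imp_deriv by blast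
  show out: "\<phi> x = 0" if "x \<notin> {a..c}" for x
  proof (cases "x < a")
    case False
    with that have "c \<le> x" by auto
    have "integral {c..x} \<zeta> = integral {c..x} (\<lambda>x. 0::real)"
      by (intro integral_cong) (use supp in auto)
    then show ?thesis
      using Henstock_Kurzweil_Integration.integral_combine[OF \<open>a \<le> c\<close> \<open>c \<le> x\<close> int] mean by (simp add: \<phi>_def)
  qed (use \<phi>_left in simp)
  have "{x. \<phi> x \<noteq> 0} \<subseteq> {a..c}"
    using out by blast
  then have "compact (closure {x. \<phi> x \<noteq> 0})"
    using bounded_closed_interval bounded_subset compact_closure by blast
  with smooth_of_bump_sum_deriv[OF der \<zeta>] show "test_function \<phi>"
    by (simp add: test_function_def)
qed

text \<open>The primitive of the difference of the indicators of \<open>{a..a+d}\<close> and \<open>{b..b+d}\<close>: it rises from \<open>0\<close>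
  to \<open>d\<close>, stays there, and returns to \<open>0\<close>.\<close>
definition trapezoid :: "real \<Rightarrow> real \<Rightarrow> real \<Rightarrow> real \<Rightarrow> real" where
  "trapezoid a b d x = max 0 (min x (a + d) - a) - max 0 (min x (b + d) - b)"

lemma integral_indicator_Ioo:
  assumes "0 < d" "a \<le> u"
  shows "integral {a..x} (indicator {u<..<u+d} :: real \<Rightarrow> real) = max 0 (min x (u + d) - u)"
proof -
  have "integral {a..x} (indicator {u<..<u+d} :: real \<Rightarrow> real)
      = integral {a..x} (indicator {u..u+d} :: real \<Rightarrow> real)"
    by (rule integral_spike[of "{u,u+d}"]) (auto simp: indicator_def)
  also have "\<dots> = integral ({u..u+d} \<inter> {a..x}) (\<lambda>_. 1::real)"
    unfolding indicator_def [abs_def] of_bool_def by (rule integral_restrict_Int)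
  also have "{u..u+d} \<inter> {a..x} = {u..min x (u+d)}"
    using assms by auto
  also have "integral {u..min x (u+d)} (\<lambda>_. 1::real) = max 0 (min x (u + d) - u)"
    by auto
  finally show ?thesis .
qed

lemma bump_integral_tendsto:
  assumes "0 < d" "a \<le> u"
  shows "(\<lambda>k. integral {a..x} (bump k u (u+d))) \<longlonglongrightarrow> max 0 (min x (u + d) - u)"
  unfolding integral_indicator_Ioo[OF assms, symmetric]
  by (rule dominated_convergence(2)[where h = "\<lambda>_. 1"])
     (auto intro: integrable_continuous_real continuous_on_bump bump_tendsto simp: bump_bounds)

lemma integral_indicator_scaleR:
  fixes g :: "real \<Rightarrow> complex"
  assumes "a \<le> u" "u + d \<le> c"
  shows "integral {a..c} (\<lambda>x. indicator {u<..<u+d} x *\<^sub>R g x) = integral {u..u+d} g"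
proof -
  have "integral {a..c} (\<lambda>x. indicator {u<..<u+d} x *\<^sub>R g x)
      = integral {a..c} (\<lambda>x. if x \<in> {u<..<u+d} then g x else 0)"
    by (rule integral_cong) (auto simp: indicator_def)
  also have "\<dots> = integral ({u<..<u+d} \<inter> {a..c}) g"
    by (rule integral_restrict_Int)
  also have "{u<..<u+d} \<inter> {a..c} = {u<..<u+d}"
    using assms by auto
  finally show ?thesis
    by (simp add: integral_open_interval_real)
qed

text \<open>Apply the definition of the generalized derivative to the primitives \<open>\<phi> k\<close> of differences of
  bumps and let \<open>k \<rightarrow> \<infinity>\<close>; both sides converge by dominated convergence.\<close>
lemma weak_derivative_trapezoid:
  assumes gen: "has_generalized_derivative g g'" and "0 < d" "a \<le> b" "b + d \<le> c"
  shows "integral {a..a+d} g - integral {b..b+d} g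
       = - integral {a..c} (\<lambda>x. trapezoid a b d x *\<^sub>R g' x)"
proof -
  have abs_int: "g absolutely_integrable_on {u..v}" "g' absolutely_integrable_on {u..v}" for u v
    using gen by (auto simp: has_generalized_derivative_def intro: locally_integrable_absolutely)
  define \<zeta> where "\<zeta> k x = bump k a (a+d) x - bump k b (b+d) x" for k x
  define \<phi> where "\<phi> k x = integral {a..x} (\<zeta> k)" for k x
  have bump_cont: "bump k u v integrable_on {p..q}" for k u v p q
    by (intro integrable_continuous_real continuous_on_bump)
  have \<zeta>_cont: "continuous_on S (\<zeta> k)" for k S
    unfolding \<zeta>_def [abs_def] by (intro continuous_intros continuous_on_bump)
  have \<zeta>_bd: "\<bar>\<zeta> k x\<bar> \<le> 1" for k x
    using bump_bounds[of k a "a+d" x] bump_bounds[of k b "b+d" x] by (auto simp: \<zeta>_def)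
  have \<zeta>_sum: "bump_sum (\<zeta> k)" for k
  proof -
    have "\<zeta> k = (\<lambda>x. flat 1 (real k * (x - a)) * flat 1 (real k * (a + d - x)) +
          flat (smult (-1) 1) (real k * (x - b)) * flat 1 (real k * (b + d - x)))"
      unfolding flat_smult by (auto simp: \<zeta>_def bump_def)
    then show ?thesis
      by (simp only:) (intro bump_sum.intros)
  qed
  have \<phi>_tendsto: "(\<lambda>k. \<phi> k x) \<longlonglongrightarrow> trapezoid a b d x" for x
    unfolding \<phi>_def \<zeta>_def trapezoid_def
    using assms by (simp add: integral_diff bump_cont) (intro tendsto_diff bump_integral_tendsto; simp)
  have supp: "\<zeta> k x = 0" if "x \<notin> {a<..<c}" for k x
    using that assms by (auto simp: \<zeta>_def bump_outside)
  have mean: "integral {a..c} (\<zeta> k) = 0" for k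
  proof -
    have eq: "integral {a..c} (bump k u (u+d)) = integral {0..d} (bump k 0 d)" if "a \<le> u" "u + d \<le> c" for u
    proof -
      have "integral {a..c} (bump k u (u+d)) = integral {u..u+d} (bump k u (u+d))"
      proof -
        have "integral {a..c} (bump k u (u+d))
            = integral {a..c} (\<lambda>x. if x \<in> {u..u+d} then bump k u (u+d) x else 0)"
          by (intro integral_cong) (auto simp: bump_outside)
        also have "\<dots> = integral ({u..u+d} \<inter> {a..c}) (bump k u (u+d))"
          by (rule integral_restrict_Int)
        also have "{u..u+d} \<inter> {a..c} = {u..u+d}"
          using that by auto
        finally show ?thesis .
      qed
      also have "\<dots> = integral {u-u..u+d-u} (\<lambda>x. bump k u (u+d) (x + u))"
        by (rule integral_shift_real_ivl[symmetric])
      also have "(\<lambda>x. bump k u (u+d) (x + u)) = bump k 0 d"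
        using bump_translate[of k 0 u d] by (simp add: add.commute)
      finally show ?thesis by simp
    qed
    show ?thesis
      using eq[of a] eq[of b] assms unfolding \<zeta>_def [abs_def] by (simp add: integral_diff bump_cont)
  qed
  have "a \<le> c" using assms by simp
  have prim: "test_function (\<phi> k)" "deriv (\<phi> k) = \<zeta> k" "x \<notin> {a..c} \<Longrightarrow> \<phi> k x = 0" for k x
    using bump_primitive[OF \<zeta>_sum _ \<open>a \<le> c\<close> mean, of k] supp unfolding \<phi>_def [abs_def] by auto
  have \<phi>_bd: "\<bar>\<phi> k x\<bar> \<le> c - a" if "x \<in> {a..c}" for k x
  proof -
    have "norm (integral {a..x} (\<zeta> k)) \<le> integral {a..x} (\<lambda>_. 1)"
      by (rule integral_norm_bound_integral) (use \<zeta>_bd \<zeta>_cont in \<open>auto intro: integrable_continuous_real\<close>)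
    then show ?thesis using that by (auto simp: \<phi>_def)
  qed
  have \<phi>_meas: "\<phi> k \<in> borel_measurable (lebesgue_on {a..c})" for k
    by (intro continuous_imp_measurable_on_sets_lebesgue)
       (auto simp: \<phi>_def [abs_def] intro!: indefinite_integral_continuous_1 integrable_continuous_real \<zeta>_cont)
  have \<zeta>_meas: "\<zeta> k \<in> borel_measurable (lebesgue_on {a..c})" for k
    by (intro continuous_imp_measurable_on_sets_lebesgue \<zeta>_cont) auto
  have int\<zeta>: "(\<lambda>x. \<zeta> k x *\<^sub>R g x) absolutely_integrable_on {a..c}" for k
    by (intro absolutely_integrable_scaleR_bounded[where K=1] abs_int \<zeta>_meas \<zeta>_bd)
  have int\<phi>: "(\<lambda>x. \<phi> k x *\<^sub>R g' x) absolutely_integrable_on {a..c}" for k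
    by (intro absolutely_integrable_scaleR_bounded[where K="c-a"] abs_int \<phi>_meas \<phi>_bd)
  have weak: "integral {a..c} (\<lambda>x. \<zeta> k x *\<^sub>R g x) = - integral {a..c} (\<lambda>x. \<phi> k x *\<^sub>R g' x)" for k
  proof -
    have "(LINT x|lebesgue. g x * of_real (deriv (\<phi> k) x)) = - (LINT x|lebesgue. g' x * of_real (\<phi> k x))"
      using gen prim(1)[of k] unfolding has_generalized_derivative_def by blast
    then have "(LINT x|lebesgue. \<zeta> k x *\<^sub>R g x) = - (LINT x|lebesgue. \<phi> k x *\<^sub>R g' x)"
      by (simp add: prim(2) scaleR_conv_of_real mult.commute)
    moreover have "(LINT x|lebesgue. \<zeta> k x *\<^sub>R g x) = integral {a..c} (\<lambda>x. \<zeta> k x *\<^sub>R g x)"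
      by (rule lebesgue_integral_supported[OF int\<zeta>]) (use supp in auto)
    moreover have "(LINT x|lebesgue. \<phi> k x *\<^sub>R g' x) = integral {a..c} (\<lambda>x. \<phi> k x *\<^sub>R g' x)"
      by (rule lebesgue_integral_supported[OF int\<phi>]) (use prim(3) in auto)
    ultimately show ?thesis by simp
  qed
  let ?Z = "\<lambda>x. indicator {a<..<a+d} x - indicator {b<..<b+d} x :: real"
  have ig: "(\<lambda>x. norm (g x)) integrable_on {a..c}" "(\<lambda>x. norm (g' x)) integrable_on {a..c}"
    using abs_int by (auto simp: absolutely_integrable_on_def)
  have "(\<lambda>k. integral {a..c} (\<lambda>x. \<zeta> k x *\<^sub>R g x)) \<longlonglongrightarrow> integral {a..c} (\<lambda>x. ?Z x *\<^sub>R g x)"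
  proof (rule dominated_convergence(2)[where h = "\<lambda>x. norm (g x)"])
    show "norm (\<zeta> k x *\<^sub>R g x) \<le> norm (g x)" for k x
      using mult_right_mono[OF \<zeta>_bd[of k x] norm_ge_zero[of "g x"]] by simp
    show "(\<lambda>k. \<zeta> k x *\<^sub>R g x) \<longlonglongrightarrow> ?Z x *\<^sub>R g x" for x
      unfolding \<zeta>_def by (intro tendsto_intros bump_tendsto)
  qed (use int\<zeta> ig in \<open>auto simp: absolutely_integrable_on_def\<close>)
  moreover have "(\<lambda>k. - integral {a..c} (\<lambda>x. \<phi> k x *\<^sub>R g' x)) \<longlonglongrightarrow>
      - integral {a..c} (\<lambda>x. trapezoid a b d x *\<^sub>R g' x)"
  proof (intro tendsto_minus dominated_convergence(2)[where h = "\<lambda>x. (c - a) * norm (g' x)"])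
    show "norm (\<phi> k x *\<^sub>R g' x) \<le> (c - a) * norm (g' x)" if "x \<in> {a..c}" for k x
      using mult_right_mono[OF \<phi>_bd[OF that, of k] norm_ge_zero[of "g' x"]] by simp
    show "(\<lambda>k. \<phi> k x *\<^sub>R g' x) \<longlonglongrightarrow> trapezoid a b d x *\<^sub>R g' x" for x
      by (intro tendsto_intros \<phi>_tendsto)
    show "(\<lambda>x. (c - a) * norm (g' x)) integrable_on {a..c}"
      using integrable_cmul[OF ig(2), of "c - a"] by simp
  qed (use int\<phi> in \<open>auto simp: absolutely_integrable_on_def\<close>)
  ultimately have "integral {a..c} (\<lambda>x. ?Z x *\<^sub>R g x) = - integral {a..c} (\<lambda>x. trapezoid a b d x *\<^sub>R g' x)"
    unfolding weak using LIMSEQ_unique by blast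
  moreover have "integral {a..c} (\<lambda>x. ?Z x *\<^sub>R g x) = integral {a..a+d} g - integral {b..b+d} g"
  proof -
    have "(\<lambda>x. indicator {u<..<v} x *\<^sub>R g x) integrable_on {a..c}" for u v
    proof -
      have "(\<lambda>x. (indicator {u<..<v} x :: real) *\<^sub>R g x) absolutely_integrable_on {a..c}"
      proof (rule absolutely_integrable_scaleR_bounded[where K=1])
        have "(indicator {u<..<v} :: real \<Rightarrow> real) \<in> borel_measurable lebesgue"
          by (rule borel_measurable_indicator) simp
        then show "(indicator {u<..<v} :: real \<Rightarrow> real) \<in> borel_measurable (lebesgue_on {a..c})"
          by (rule measurable_restrict_space1)
      qed (auto simp: abs_int split: split_indicator)
      then show ?thesis by (simp add: absolutely_integrable_on_def)
    qed
    then show ?thesis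
      using assms by (simp add: scaleR_diff_left integral_diff integral_indicator_scaleR)
  qed
  ultimately show ?thesis by simp
qed

text \<open>Lebesgue's differentiation theorem for one-sided averages.\<close>
lemma lebesgue_point:
  fixes f :: "real \<Rightarrow> complex"
  assumes "\<And>a b. f integrable_on {a..b}"
  obtains N where "negligible N"
    "\<And>x. x \<notin> N \<Longrightarrow> ((\<lambda>h. integral {x..x+h} f /\<^sub>R h) \<longlongrightarrow> f x) (at_right 0)"
proof -
  have "f integrable_on cbox a b" for a b using assms by simp
  from integrable_ccontinuous_explicit[OF this] obtain N where "negligible N"
     and N: "\<And>x e. \<lbrakk>x \<notin> N; 0 < e\<rbrakk> \<Longrightarrow> \<exists>d>0. \<forall>h. 0 < h \<and> h < d \<longrightarrow>
                norm(integral (cbox x (x + h *\<^sub>R One)) f /\<^sub>R h ^ DIM(real) - f x) < e"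
    by blast
  have "((\<lambda>h. integral {x..x+h} f /\<^sub>R h) \<longlongrightarrow> f x) (at_right 0)" if "x \<notin> N" for x
    unfolding tendsto_iff dist_norm eventually_at_right_field
  proof (intro allI impI)
    fix e :: real assume "0 < e"
    from N[OF that this] show "\<exists>b>0. \<forall>y>0. y < b \<longrightarrow> norm (integral {x..x + y} f /\<^sub>R y - f x) < e"
      by (simp add: imp_conjL)
  qed
  with \<open>negligible N\<close> show ?thesis using that by blast
qed

lemma zero_of_zero_integrals:
  fixes f :: "real \<Rightarrow> complex"
  assumes "\<And>a b. f integrable_on {a..b}" "\<And>a b. a \<le> b \<Longrightarrow> integral {a..b} f = 0"
  obtains N where "negligible N" "\<And>x. x \<notin> N \<Longrightarrow> f x = 0"
proof -
  obtain N where N: "negligible N"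
    "\<And>x. x \<notin> N \<Longrightarrow> ((\<lambda>h. integral {x..x+h} f /\<^sub>R h) \<longlongrightarrow> f x) (at_right 0)"
    using lebesgue_point[OF assms(1)] by blast
  have "f x = 0" if "x \<notin> N" for x
  proof (rule tendsto_unique[OF _ N(2)[OF that]])
    have "\<forall>\<^sub>F h in at_right 0. integral {x..x+h} f /\<^sub>R h = 0"
      using eventually_at_right_less[of 0] by eventually_elim (use assms(2) in auto)
    then show "((\<lambda>h. integral {x..x+h} f /\<^sub>R h) \<longlongrightarrow> 0) (at_right 0)"
      by (rule tendsto_eventually)
  qed simp
  with N(1) that show ?thesis by blast
qed

text \<open>Divide the trapezoid identity by \<open>d\<close> and let \<open>d \<rightarrow> 0\<close>. At Lebesgue points \<open>a\<close> and \<open>b\<close> of \<open>g\<close> the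
  left side tends to \<open>g a - g b\<close>, while the normalized trapezoids tend boundedly to the indicator
  of \<open>{a<..b}\<close>.\<close>
lemma weak_derivative_increment:
  assumes gen: "has_generalized_derivative g g'"
  obtains N where "negligible N"
    "\<And>a b. a \<le> b \<Longrightarrow> a \<notin> N \<Longrightarrow> b \<notin> N \<Longrightarrow> g b - g a = integral {a..b} g'"
proof -
  have abs_int: "g absolutely_integrable_on {u..v}" "g' absolutely_integrable_on {u..v}" for u v
    using gen by (auto simp: has_generalized_derivative_def intro: locally_integrable_absolutely)
  then have int: "g integrable_on {u..v}" "g' integrable_on {u..v}" 
    and nint: "(\<lambda>x. norm (g' x)) integrable_on {u..v}" for u v
    by (auto simp: absolutely_integrable_on_def)
  obtain N where N: "negligible N"
    "\<And>x. x \<notin> N \<Longrightarrow> ((\<lambda>h. integral {x..x+h} g /\<^sub>R h) \<longlongrightarrow> g x) (at_right 0)"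
    using lebesgue_point[OF int(1)] by blast
  have "g b - g a = integral {a..b} g'" if "a \<le> b" "a \<notin> N" "b \<notin> N" for a b
  proof -
    define \<delta> where "\<delta> n = inverse (real (Suc n))" for n
    have \<delta>: "0 < \<delta> n" "\<delta> n \<le> 1" for n
      by (auto simp: \<delta>_def inverse_le_1_iff)
    have \<delta>0: "\<delta> \<longlonglongrightarrow> 0"
      unfolding \<delta>_def by (rule LIMSEQ_inverse_real_of_nat)
    then have lim: "filterlim \<delta> (at_right 0) sequentially"
      by (intro tendsto_imp_filterlim_at_right always_eventually) (use \<delta>(1) in auto)
    have "(\<lambda>n. integral {a..a + \<delta> n} g /\<^sub>R \<delta> n - integral {b..b + \<delta> n} g /\<^sub>R \<delta> n) \<longlonglongrightarrow> g a - g b"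
      using N(2) that by (intro tendsto_diff filterlim_compose[OF _ lim]) auto
    also have "(\<lambda>n. integral {a..a + \<delta> n} g /\<^sub>R \<delta> n - integral {b..b + \<delta> n} g /\<^sub>R \<delta> n)
        = (\<lambda>n. - integral {a..b+1} (\<lambda>x. (trapezoid a b (\<delta> n) x / \<delta> n) *\<^sub>R g' x))"
    proof
      fix n
      have "integral {a..b+1} (\<lambda>x. (trapezoid a b (\<delta> n) x / \<delta> n) *\<^sub>R g' x)
          = (1 / \<delta> n) *\<^sub>R integral {a..b+1} (\<lambda>x. trapezoid a b (\<delta> n) x *\<^sub>R g' x)"
        unfolding integral_cmul[symmetric] by simp
      then show "integral {a..a + \<delta> n} g /\<^sub>R \<delta> n - integral {b..b + \<delta> n} g /\<^sub>R \<delta> n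
          = - integral {a..b+1} (\<lambda>x. (trapezoid a b (\<delta> n) x / \<delta> n) *\<^sub>R g' x)"
        using weak_derivative_trapezoid[OF gen \<delta>(1)[of n] \<open>a \<le> b\<close>, of "b + 1"] \<delta>(2)[of n]
        by (simp add: scaleR_diff_right[symmetric] divide_inverse)
    qed
    finally have 1: "(\<lambda>n. - integral {a..b+1} (\<lambda>x. (trapezoid a b (\<delta> n) x / \<delta> n) *\<^sub>R g' x)) \<longlonglongrightarrow> g a - g b" .
    have bd: "\<bar>trapezoid a b (\<delta> n) x / \<delta> n\<bar> \<le> 1" for n x
      using \<delta>(1)[of n] \<open>a \<le> b\<close> by (auto simp: trapezoid_def max_def min_def)
    have "(\<lambda>n. integral {a..b+1} (\<lambda>x. (trapezoid a b (\<delta> n) x / \<delta> n) *\<^sub>R g' x)) \<longlonglongrightarrow>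
        integral {a..b+1} (\<lambda>x. if x \<in> {a<..b} then g' x else 0)"
    proof (rule dominated_convergence(2)[where h = "\<lambda>x. norm (g' x)"])
      show "norm ((trapezoid a b (\<delta> n) x / \<delta> n) *\<^sub>R g' x) \<le> norm (g' x)" for n x
        using mult_right_mono[OF bd[of n x] norm_ge_zero[of "g' x"]] by simp
      show "(\<lambda>x. (trapezoid a b (\<delta> n) x / \<delta> n) *\<^sub>R g' x) integrable_on {a..b + 1}" for n
      proof -
        have "(\<lambda>x. (trapezoid a b (\<delta> n) x / \<delta> n) *\<^sub>R g' x) absolutely_integrable_on {a..b + 1}"
          by (intro absolutely_integrable_scaleR_bounded[where K=1] abs_int bd 
              continuous_imp_measurable_on_sets_lebesgue)
             (use \<delta>(1)[of n] in \<open>auto simp: trapezoid_def [abs_def] intro!: continuous_intros\<close>)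
        then show ?thesis by (simp add: absolutely_integrable_on_def)
      qed
      fix x assume x: "x \<in> {a..b + 1}"
      have ev: "\<forall>\<^sub>F n in sequentially. \<delta> n < e" if "e > 0" for e
        using order_tendstoD(2)[OF \<delta>0 that] .
      consider "x = a" | "x \<in> {a<..b}" | "x > b" using x by force
      then have "\<forall>\<^sub>F n in sequentially. (trapezoid a b (\<delta> n) x / \<delta> n) *\<^sub>R g' x
            = (if x \<in> {a<..b} then g' x else 0)"
      proof cases
        case 1
        then show ?thesis using \<open>a \<le> b\<close> \<delta>(1)
          by (intro always_eventually allI) (auto simp: trapezoid_def max_def min_def)
      next
        case 2
        then have "\<forall>\<^sub>F n in sequentially. \<delta> n < x - a"
          using ev by simp
        then show ?thesis
        proof eventually_elim
          case (elim n)
          then show ?case using \<delta>(1)[of n] 2 by (auto simp: trapezoid_def max_def min_def)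
        qed
      next
        case 3
        then have "\<forall>\<^sub>F n in sequentially. \<delta> n < x - b"
          using ev by simp
        then show ?thesis
        proof eventually_elim
          case (elim n)
          then show ?case using \<delta>(1)[of n] 3 \<open>a \<le> b\<close> by (auto simp: trapezoid_def max_def min_def)
        qed
      qed
      then show "(\<lambda>n. (trapezoid a b (\<delta> n) x / \<delta> n) *\<^sub>R g' x) \<longlonglongrightarrow> (if x \<in> {a<..b} then g' x else 0)"
        by (rule tendsto_eventually)
    qed (use nint in auto)
    moreover have "integral {a..b+1} (\<lambda>x. if x \<in> {a<..b} then g' x else 0) = integral {a..b} g'"
    proof -
      have "integral {a..b+1} (\<lambda>x. if x \<in> {a<..b} then g' x else 0)
          = integral {a..b+1} (\<lambda>x. if x \<in> {a..b} then g' x else 0)"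
        by (rule integral_spike[of "{a}"]) auto
      also have "\<dots> = integral ({a..b} \<inter> {a..b+1}) g'"
        by (rule integral_restrict_Int)
      also have "{a..b} \<inter> {a..b+1} = {a..b}" by auto
      finally show ?thesis .
    qed
    ultimately have "- integral {a..b} g' = g a - g b"
      using LIMSEQ_unique[OF 1 tendsto_minus] by simp
    then show ?thesis by (metis add.inverse_inverse minus_diff_eq)
  qed
  with N(1) that show ?thesis by blast
qed

section \<open>Fourier series of continuous periodic functions\<close>

lemma integral_period_shift:
  fixes f :: "real \<Rightarrow> 'a::euclidean_space"
  assumes int: "\<And>a b. f integrable_on {a..b}" and "negligible N"
    and per: "\<And>t. t \<notin> N \<Longrightarrow> f (t + 2 * pi) = f t" and "0 \<le> c"
  shows "integral {-pi+c..pi+c} f = integral {-pi..pi} f"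
proof -
  note comb = Henstock_Kurzweil_Integration.integral_combine[OF _ _ int]
  have "integral {-pi..-pi+c} (\<lambda>t. f (t + 2*pi)) = integral {pi..pi+c} f"
    using integral_shift_real_ivl[of pi "2*pi" "pi+c" f] by (simp add: algebra_simps)
  moreover have "integral {-pi..-pi+c} (\<lambda>t. f (t + 2*pi)) = integral {-pi..-pi+c} f"
    by (rule integral_spike[OF \<open>negligible N\<close>]) (simp add: per)
  moreover have "integral {-pi..-pi+c} f + integral {-pi+c..pi+c} f = integral {-pi..pi+c} f"
    "integral {-pi..pi} f + integral {pi..pi+c} f = integral {-pi..pi+c} f"
    using \<open>0 \<le> c\<close> pi_gt_zero by (intro comb; linarith)+
  ultimately show ?thesis
    by (metis (no_types, lifting) add.commute add_left_cancel)
qed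

definition fourier_coeff :: "(real \<Rightarrow> complex) \<Rightarrow> int \<Rightarrow> complex" where
  "fourier_coeff u n = integral {-pi..pi} (\<lambda>t. u t * cis (- (of_int n * t))) / (2 * of_real pi)"

lemma continuous_on_cis_mult [continuous_intros]: "continuous_on S (\<lambda>t. cis (c * t))"
  by (intro continuous_intros)

lemma integral_cis:
  "integral {-pi..pi} (\<lambda>t. cis (of_int n * t)) = (if n = 0 then 2 * of_real pi else 0)"
proof (cases "n = 0")
  case False
  let ?F = "\<lambda>t::real. cis (of_int n * t) / (\<i> * of_int n)"
  have "((\<lambda>t. cis (of_int n * t)) has_integral ?F pi - ?F (-pi)) {-pi..pi}"
  proof (rule fundamental_theorem_of_calculus)
    fix t :: real
    have "((\<lambda>t. exp (of_real t * (\<i> * of_int n)) / (\<i> * of_int n)) has_vector_derivative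
         exp (of_real t * (\<i> * of_int n))) (at t within {-pi..pi})"
      by (rule has_vector_derivative_real_field)
         (auto intro!: derivative_eq_intros simp: False)
    then show "(?F has_vector_derivative cis (of_int n * t)) (at t within {-pi..pi})"
      by (simp add: cis_conv_exp mult_ac)
  qed simp
  moreover have "cis (of_int n * pi) = cis (of_int n * - pi)"
    using cis_multiple_2pi[of n] cis_mult[of "of_int n * - pi" "2 * pi * of_int n"]
    by (simp add: algebra_simps)
  ultimately have "((\<lambda>t. cis (of_int n * t)) has_integral 0) {-pi..pi}"
    by (simp only: diff_self)
  then show ?thesis using False by (simp add: integral_unique)
qed (simp add: scaleR_conv_of_real)

lemma integrable_times_cis:
  assumes "continuous_on {-pi..pi} u"
  shows "(\<lambda>t. u t * cis (c * t)) integrable_on {-pi..pi}"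
  by (intro integrable_continuous_real continuous_intros assms)

lemma integrable_times_cis':
  assumes "continuous_on {-pi..pi} u"
  shows "(\<lambda>t. u t * cis (- (c * t))) integrable_on {-pi..pi}"
  using integrable_times_cis[OF assms, of "-c"] by simp

definition trig :: "int set \<Rightarrow> (int \<Rightarrow> complex) \<Rightarrow> real \<Rightarrow> complex" where
  "trig F c t = (\<Sum>n\<in>F. c n * cis (of_int n * t))"

lemma continuous_on_trig [continuous_intros]: "continuous_on S (trig F c)"
  unfolding trig_def [abs_def] by (intro continuous_intros)

lemma fourier_coeff_trig:
  assumes "finite F"
  shows "fourier_coeff (trig F c) n = (if n \<in> F then c n else 0)"
proof -
  have "integral {-pi..pi} (\<lambda>t. trig F c t * cis (- (of_int n * t)))
      = integral {-pi..pi} (\<lambda>t. \<Sum>m\<in>F. c m * cis (of_int (m - n) * t))"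
    by (intro integral_cong)
       (simp add: trig_def sum_distrib_right cis_mult mult.assoc left_diff_distrib)
  also have "\<dots> = (\<Sum>m\<in>F. integral {-pi..pi} (\<lambda>t. c m * cis (of_int (m - n) * t)))"
    by (intro integral_sum assms integrable_continuous_real continuous_intros)
  also have "\<dots> = (\<Sum>m\<in>F. c m * (if m - n = 0 then 2 * of_real pi else 0))"
    by (intro sum.cong refl) (simp only: integral_mult_right integral_cis)
  also have "\<dots> = (\<Sum>m\<in>F. if m = n then c m * (2 * of_real pi) else 0)"
    by (intro sum.cong) auto
  finally show ?thesis
    using assms by (simp add: fourier_coeff_def sum.delta)
qed

lemma integral_times_cnj_trig:
  assumes u: "continuous_on {-pi..pi} u" and "finite F"
  shows "integral {-pi..pi} (\<lambda>t. u t * cnj (trig F c t))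
       = 2 * of_real pi * (\<Sum>n\<in>F. cnj (c n) * fourier_coeff u n)"
proof -
  have "integral {-pi..pi} (\<lambda>t. u t * cnj (trig F c t))
      = integral {-pi..pi} (\<lambda>t. \<Sum>n\<in>F. cnj (c n) * (u t * cis (- (of_int n * t))))"
    by (intro integral_cong) (simp add: trig_def sum_distrib_left cis_cnj mult_ac)
  also have "\<dots> = (\<Sum>n\<in>F. integral {-pi..pi} (\<lambda>t. cnj (c n) * (u t * cis (- (of_int n * t)))))"
    by (intro integral_sum assms integrable_continuous_real continuous_intros)
  also have "\<dots> = (\<Sum>n\<in>F. cnj (c n) * (2 * of_real pi * fourier_coeff u n))"
    by (intro sum.cong refl) (simp add: fourier_coeff_def)
  finally show ?thesis
    by (simp add: sum_distrib_left mult_ac)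
qed

text \<open>The partial sum \<open>P\<close> satisfies \<open>\<integral> u * cnj P = \<integral> P * cnj P\<close>, which is \<open>2 * pi\<close> times the sum of squares;
  so \<open>0 \<le> \<integral>\<bar>u - P\<bar>\<^sup>2\<close> expands to the claim.\<close>
lemma bessel_inequality:
  assumes u: "continuous_on {-pi..pi} u" and "finite F"
  shows "2 * pi * (\<Sum>n\<in>F. (norm (fourier_coeff u n))\<^sup>2) \<le> integral {-pi..pi} (\<lambda>t. (norm (u t))\<^sup>2)"
proof -
  define P where "P = trig F (fourier_coeff u)"
  define S where "S = (\<Sum>n\<in>F. (norm (fourier_coeff u n))\<^sup>2)"
  have P: "continuous_on {-pi..pi} P"
    unfolding P_def by (intro continuous_intros)
  have int: "(\<lambda>t. v t * cnj (w t)) integrable_on {-pi..pi}"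
    if "continuous_on {-pi..pi} v" "continuous_on {-pi..pi} w" for v w :: "real \<Rightarrow> complex"
    by (intro integrable_continuous_real continuous_intros that)
  have S: "(\<Sum>n\<in>F. cnj (fourier_coeff u n) * fourier_coeff u n) = of_real S"
    unfolding S_def of_real_sum by (intro sum.cong refl) (simp only: complex_norm_square mult.commute)
  have 1: "integral {-pi..pi} (\<lambda>t. u t * cnj (P t)) = 2 * pi * S"
    unfolding P_def integral_times_cnj_trig[OF assms] S by simp
  have 2: "integral {-pi..pi} (\<lambda>t. P t * cnj (P t)) = 2 * pi * S"
  proof -
    have "integral {-pi..pi} (\<lambda>t. P t * cnj (P t))
        = 2 * of_real pi * (\<Sum>n\<in>F. cnj (fourier_coeff u n) * fourier_coeff P n)"
      unfolding P_def by (intro integral_times_cnj_trig continuous_intros assms)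
    also have "(\<Sum>n\<in>F. cnj (fourier_coeff u n) * fourier_coeff P n) = of_real S"
      unfolding S[symmetric] P_def
      by (intro sum.cong refl) (simp add: fourier_coeff_trig[OF \<open>finite F\<close>])
    finally show ?thesis by simp
  qed
  have 3: "integral {-pi..pi} (\<lambda>t. P t * cnj (u t)) = 2 * pi * S"
  proof -
    have "integral {-pi..pi} (\<lambda>t. cnj (u t * cnj (P t))) = cnj (integral {-pi..pi} (\<lambda>t. u t * cnj (P t)))"
      by (rule integral_cnj[symmetric])
    then show ?thesis unfolding 1 by (simp add: mult.commute)
  qed
  have sq: "integral {-pi..pi} (\<lambda>t. v t * cnj (v t)) = of_real (integral {-pi..pi} (\<lambda>t. (norm (v t))\<^sup>2))"
    if "continuous_on {-pi..pi} v" for v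
  proof -
    have "((\<lambda>t. (norm (v t))\<^sup>2) has_integral integral {-pi..pi} (\<lambda>t. (norm (v t))\<^sup>2)) {-pi..pi}"
      by (intro integrable_integral integrable_continuous_real continuous_intros that)
    then have "((\<lambda>t. complex_of_real ((norm (v t))\<^sup>2)) has_integral
        of_real (integral {-pi..pi} (\<lambda>t. (norm (v t))\<^sup>2))) {-pi..pi}"
      by (rule has_integral_of_real)
    then show ?thesis
      unfolding complex_norm_square by (rule integral_unique)
  qed
  have "0 \<le> integral {-pi..pi} (\<lambda>t. (norm (u t - P t))\<^sup>2)"
    by (intro integral_nonneg integrable_continuous_real continuous_intros u P) auto
  moreover have "complex_of_real (integral {-pi..pi} (\<lambda>t. (norm (u t - P t))\<^sup>2))
      = of_real (integral {-pi..pi} (\<lambda>t. (norm (u t))\<^sup>2) - 2 * pi * S)"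
  proof -
    have "complex_of_real (integral {-pi..pi} (\<lambda>t. (norm (u t - P t))\<^sup>2))
       = integral {-pi..pi} (\<lambda>t. (u t - P t) * cnj (u t - P t))"
      by (intro sq[symmetric] continuous_intros u P)
    also have "\<dots> = integral {-pi..pi} (\<lambda>t. (u t * cnj (u t) - u t * cnj (P t))
                                          - (P t * cnj (u t) - P t * cnj (P t)))"
      by (intro integral_cong) (simp add: algebra_simps)
    also have "\<dots> = integral {-pi..pi} (\<lambda>t. u t * cnj (u t) - u t * cnj (P t))
                  - integral {-pi..pi} (\<lambda>t. P t * cnj (u t) - P t * cnj (P t))"
      by (intro integral_diff integrable_diff int u P)
    also have "\<dots> = (integral {-pi..pi} (\<lambda>t. u t * cnj (u t)) - integral {-pi..pi} (\<lambda>t. u t * cnj (P t)))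
                  - (integral {-pi..pi} (\<lambda>t. P t * cnj (u t)) - integral {-pi..pi} (\<lambda>t. P t * cnj (P t)))"
      by (intro arg_cong2[where f = minus] integral_diff int u P)
    finally show ?thesis
      unfolding 1 2 3 sq[OF u] by simp
  qed
  ultimately show ?thesis
    unfolding of_real_eq_iff S_def by simp
qed

text \<open>The lift is \<open>D \<circ> Arg\<close>. The argument jumps on the negative axis, but there \<open>Arg (- z) + pi\<close> is a
  continuous choice of angle, and periodicity makes \<open>D\<close> blind to the choice.\<close>
lemma continuous_on_circle_lift:
  fixes D :: "real \<Rightarrow> complex"
  assumes cont: "continuous_on UNIV D" and per: "\<And>t. D (t + 2 * pi) = D t"
  obtains f where "continuous_on (sphere 0 1) f" "\<And>t. f (cis t) = D t"
proof
  have per_int: "D (t + 2 * pi * of_int n) = D t" for t n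
  proof -
    interpret periodic_fun_simple D "2 * pi"
      by unfold_locales (rule per)
    show ?thesis using plus_of_int[of t n] by (simp add: mult_ac)
  qed
  have D_eq: "D s = D t" if "cis s = cis t" for s t
  proof -
    from that obtain n :: int where "s = t + 2 * pi * n"
      using sin_cos_eq_iff[of s t] by (auto simp: cis.ctr complex_eq_iff)
    then show ?thesis using per_int by simp
  qed
  show 1: "D (Arg (cis t)) = D t" for t
    by (rule D_eq) (simp add: cis_Arg sgn_eq)
  have isD: "isCont D t" for t
    using cont by (simp add: continuous_on_eq_continuous_at)
  have 2: "D (Arg (- z) + pi) = D (Arg z)" if "z \<in> sphere 0 1" for z
  proof (rule D_eq)
    have "z \<noteq> 0" "norm z = 1" using that by auto
    then have "cis (Arg (-z)) = - z" "cis (Arg z) = z"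
      by (simp_all add: cis_Arg sgn_eq)
    moreover have "cis (Arg (-z) + pi) = - cis (Arg (-z))"
      by (simp add: complex_eq_iff)
    ultimately show "cis (Arg (-z) + pi) = cis (Arg z)"
      by simp
  qed
  show "continuous_on (sphere 0 1) (\<lambda>z. D (Arg z))"
    unfolding continuous_on_eq_continuous_within
  proof
    fix z :: complex assume z: "z \<in> sphere 0 1"
    show "continuous (at z within sphere 0 1) (\<lambda>z. D (Arg z))"
    proof (cases "z \<in> \<real>\<^sub>\<le>\<^sub>0")
      case False
      then have "isCont (\<lambda>z. D (Arg z)) z"
        using isCont_o2[OF continuous_at_Arg isD] by blast
      then show ?thesis by (rule continuous_at_imp_continuous_at_within)
    next
      case True
      then have "- z \<notin> \<real>\<^sub>\<le>\<^sub>0"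
        using z by (auto simp: complex_nonpos_Reals_iff complex_eq_iff cmod_def)
      then have "isCont Arg (- z)" by (rule continuous_at_Arg)
      then have "isCont (\<lambda>w. Arg (- w)) z"
        by (intro isCont_o2[of z uminus Arg] continuous_intros)
      then have "isCont (\<lambda>w. Arg (- w) + pi) z"
        by (rule isCont_add) (rule continuous_const)
      then have "isCont (\<lambda>z. D (Arg (- z) + pi)) z"
        by (rule isCont_o2) (rule isD)
      then have "continuous (at z within sphere 0 1) (\<lambda>z. D (Arg (- z) + pi))"
        by (rule continuous_at_imp_continuous_at_within)
      then show ?thesis
        by (rule continuous_transform_within[where \<delta> = 1]) (use z 2 in auto)
    qed
  qed
qed

text \<open>Generalizing over \<open>D\<close> is what makes the induction pass products: if \<open>D\<close> is orthogonal to all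
  exponentials then so is \<open>D * f\<close>, and the hypothesis for \<open>g\<close> applies to that function.\<close>
lemma orthogonal_to_circle_polynomials:
  assumes "real_polynomial_function q" 
    and "continuous_on {-pi..pi} D"
    and "\<And>n::int. integral {-pi..pi} (\<lambda>t. D t * cis (of_int n * t)) = 0"
  shows "integral {-pi..pi} (\<lambda>t. D t * of_real (q (cis t)) * cis (of_int n * t)) = 0"
  using assms
proof (induction arbitrary: D n)
  case (linear f)
  have f_eq: "f (cis t) = f 1 * cos t + f \<i> * sin t" for t
  proof -
    interpret bounded_linear f by fact
    have "cis t = cos t *\<^sub>R 1 + sin t *\<^sub>R \<i>"
      by (simp add: complex_eq_iff)
    then show ?thesis by (simp only: add scaleR) simp
  qed
  define A where "A = (of_real (f 1) - \<i> * of_real (f \<i>)) / 2"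
  define B where "B = (of_real (f 1) + \<i> * of_real (f \<i>)) / 2"
  have f_cis: "of_real (f (cis t)) = A * cis t + B * cis (-t)" for t
    unfolding f_eq A_def B_def by (simp add: complex_eq_iff field_simps)
  have "integral {-pi..pi} (\<lambda>t. D t * of_real (f (cis t)) * cis (of_int n * t))
      = integral {-pi..pi} (\<lambda>t. A * (D t * cis (of_int (n + 1) * t)) + B * (D t * cis (of_int (n - 1) * t)))"
  proof (rule integral_cong)
    fix t
    have "cis (of_int (n + 1) * t) = cis t * cis (of_int n * t)"
         "cis (of_int (n - 1) * t) = cis (-t) * cis (of_int n * t)"
      unfolding cis_mult by (simp_all add: algebra_simps)
    then show "D t * of_real (f (cis t)) * cis (of_int n * t)
      = A * (D t * cis (of_int (n + 1) * t)) + B * (D t * cis (of_int (n - 1) * t))"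
      unfolding f_cis by (simp add: algebra_simps)
  qed
  also have "\<dots> = integral {-pi..pi} (\<lambda>t. A * (D t * cis (of_int (n + 1) * t)))
      + integral {-pi..pi} (\<lambda>t. B * (D t * cis (of_int (n - 1) * t)))"
    by (intro integral_add integrable_continuous_real continuous_intros linear.prems(1))
  also have "\<dots> = 0"
    by (simp only: integral_mult_right linear.prems(2)) simp
  finally show ?case .
next
  case (const c)
  have "integral {-pi..pi} (\<lambda>t. D t * of_real c * cis (of_int n * t))
      = integral {-pi..pi} (\<lambda>t. of_real c * (D t * cis (of_int n * t)))"
    by (intro integral_cong) (simp add: mult_ac)
  then show ?case
    by (simp only: integral_mult_right const.prems(2)) simp
next
  case (add f g)
  have cont: "continuous_on {-pi..pi} (\<lambda>t. complex_of_real (h (cis t)))"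
    if "real_polynomial_function h" for h
    using continuous_on_compose2[OF continuous_on_polymonial_function[of h UNIV] continuous_on_cis_mult[of _ 1]] that
    by (auto simp: real_polynomial_function_eq intro!: continuous_intros)
  have "integral {-pi..pi} (\<lambda>t. D t * of_real (f (cis t) + g (cis t)) * cis (of_int n * t))
     = integral {-pi..pi} (\<lambda>t. D t * of_real (f (cis t)) * cis (of_int n * t)
            + D t * of_real (g (cis t)) * cis (of_int n * t))"
    by (intro integral_cong) (simp add: algebra_simps)
  also have "\<dots> = integral {-pi..pi} (\<lambda>t. D t * of_real (f (cis t)) * cis (of_int n * t))
            + integral {-pi..pi} (\<lambda>t. D t * of_real (g (cis t)) * cis (of_int n * t))"
    by (intro integral_add integrable_continuous_real continuous_intros cont add.prems(1) add.hyps)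
  also have "\<dots> = 0"
    by (simp only: add.IH[OF add.prems]) simp
  finally show ?case .
next
  case (mult f g)
  have cont: "continuous_on {-pi..pi} (\<lambda>t. complex_of_real (f (cis t)))"
    using continuous_on_compose2[OF continuous_on_polymonial_function[of f UNIV] continuous_on_cis_mult[of _ 1]] mult
    by (auto simp: real_polynomial_function_eq intro!: continuous_intros)
  have "integral {-pi..pi} (\<lambda>t. (D t * of_real (f (cis t))) * of_real (g (cis t)) * cis (of_int n * t)) = 0"
    by (rule mult.IH(2)) (auto intro!: continuous_intros cont mult)
  then show ?case by (simp add: mult_ac)
qed

text \<open>Approximating \<open>Re D\<close> uniformly by polynomials on the circle, to which \<open>D\<close> is orthogonal, gives
  \<open>\<integral> D * Re D = 0\<close>; the real part of this integral is \<open>\<integral> (Re D)\<^sup>2\<close>.\<close>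
lemma Re_zero_of_fourier_coeffs_zero:
  assumes cont: "continuous_on UNIV D" and per: "\<And>t. D (t + 2 * pi) = D t"
    and coeff: "\<And>n. fourier_coeff D n = 0" and "t \<in> {-pi..pi}"
  shows "Re (D t) = 0"
proof -
  have contD: "continuous_on {-pi..pi} D"
    using cont continuous_on_subset by blast
  have orth: "integral {-pi..pi} (\<lambda>t. D t * cis (of_int n * t)) = 0" for n
    using coeff[of "-n"] by (simp add: fourier_coeff_def)
  obtain f where f: "continuous_on (sphere 0 1) f" "\<And>t. f (cis t) = D t"
    using continuous_on_circle_lift[OF cont per] by blast
  obtain K where K: "\<And>t. t \<in> {-pi..pi} \<Longrightarrow> norm (D t) \<le> K"
    using compact_imp_bounded[OF compact_continuous_image[OF contD compact_Icc]]
    by (metis bounded_iff imageI)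
  have small: "norm (integral {-pi..pi} (\<lambda>t. D t * of_real (Re (D t)))) \<le> e * (K * (2 * pi))" if e: "e > 0" for e
  proof -
    have "continuous_on (sphere 0 1) (\<lambda>z. Re (f z))"
      by (intro continuous_intros f(1))
    then obtain q where q: "real_polynomial_function q" "\<And>z. z \<in> sphere 0 1 \<Longrightarrow> \<bar>Re (f z) - q z\<bar> < e"
      using Stone_Weierstrass_real_polynomial_function[OF compact_sphere _ e] by metis
    have contq: "continuous_on {-pi..pi} (\<lambda>t. complex_of_real (q (cis t)))"
      using continuous_on_compose2[OF continuous_on_polymonial_function[of q UNIV] continuous_on_cis_mult[of _ 1]] q(1)
      by (auto simp: real_polynomial_function_eq intro!: continuous_intros)
    have "integral {-pi..pi} (\<lambda>t. D t * of_real (q (cis t))) = 0"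
      using orthogonal_to_circle_polynomials[OF q(1) contD orth, of 0] by simp
    moreover have "integral {-pi..pi} (\<lambda>t. D t * of_real (Re (D t)) - D t * of_real (q (cis t)))
        = integral {-pi..pi} (\<lambda>t. D t * of_real (Re (D t))) - integral {-pi..pi} (\<lambda>t. D t * of_real (q (cis t)))"
      by (intro integral_diff integrable_continuous_real continuous_intros contD contq)
    ultimately have "integral {-pi..pi} (\<lambda>t. D t * of_real (Re (D t)))
       = integral {-pi..pi} (\<lambda>t. D t * of_real (Re (D t)) - D t * of_real (q (cis t)))"
      by simp
    also have "norm \<dots> \<le> (e * K) * (pi - (- pi))"
    proof (rule integral_bound)
      show "continuous_on {-pi..pi} (\<lambda>t. D t * of_real (Re (D t)) - D t * of_real (q (cis t)))"
        by (intro continuous_intros contD contq)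
      fix t :: real assume t: "t \<in> {-pi..pi}"
      have "\<bar>Re (D t) - q (cis t)\<bar> < e" using q(2)[of "cis t"] f(2) by simp
      then have "\<bar>Re (D t) - q (cis t)\<bar> * norm (D t) \<le> e * K"
        using K[OF t] by (intro mult_mono) auto
      moreover have "norm (D t * of_real (Re (D t)) - D t * of_real (q (cis t))) = \<bar>Re (D t) - q (cis t)\<bar> * norm (D t)"
        by (metis mult.commute norm_mult norm_of_real of_real_diff right_diff_distrib')
      ultimately show "norm (D t * of_real (Re (D t)) - D t * of_real (q (cis t))) \<le> e * K" by simp
    qed simp
    finally show ?thesis by (simp add: mult_ac)
  qed
  have "norm (integral {-pi..pi} (\<lambda>t. D t * of_real (Re (D t)))) \<le> 0"
  proof (rule field_le_epsilon)
    fix e :: real assume "e > 0"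
    have "K \<ge> 0" using order_trans[OF norm_ge_zero K[of 0]] by simp
    define c where "c = K * (2 * pi) + 1"
    have "c > 0" using \<open>K \<ge> 0\<close> by (simp add: c_def add_nonneg_pos)
    have "norm (integral {-pi..pi} (\<lambda>t. D t * of_real (Re (D t)))) \<le> e / c * (K * (2 * pi))"
      by (rule small) (use \<open>c > 0\<close> \<open>e > 0\<close> in auto)
    also have "\<dots> \<le> e / c * c"
      using \<open>c > 0\<close> \<open>e > 0\<close> by (intro mult_left_mono) (auto simp: c_def)
    finally show "norm (integral {-pi..pi} (\<lambda>t. D t * of_real (Re (D t)))) \<le> 0 + e"
      using \<open>c > 0\<close> by simp
  qed
  then have "integral {-pi..pi} (\<lambda>t. D t * of_real (Re (D t))) = 0" by simp
  moreover have "integral {-pi..pi} (\<lambda>t. Re (D t * of_real (Re (D t))))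
        = Re (integral {-pi..pi} (\<lambda>t. D t * of_real (Re (D t))))"
    by (rule integral_linear[unfolded o_def, OF _ bounded_linear_Re, of "\<lambda>t. D t * of_real (Re (D t))"])
       (auto intro!: integrable_continuous_real continuous_intros contD)
  ultimately have 0: "integral {-pi..pi} (\<lambda>t. (Re (D t))\<^sup>2) = 0"
    by (simp add: power2_eq_square)
  have "continuous_on {-pi..pi} (\<lambda>t. (Re (D t))\<^sup>2)"
    by (intro continuous_intros contD)
  moreover have "- pi < pi" using pi_gt_zero by linarith
  ultimately have "\<forall>x\<in>{-pi..pi}. (Re (D x))\<^sup>2 = 0"
    using 0 integral_eq_0_iff[of "-pi" pi "\<lambda>t. (Re (D t))\<^sup>2"] zero_le_power2 by metis
  then show ?thesis using \<open>t \<in> {-pi..pi}\<close> by simp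
qed

lemma zero_of_fourier_coeffs_zero:
  assumes cont: "continuous_on UNIV D" and per: "\<And>t. D (t + 2 * pi) = D t"
    and coeff: "\<And>n. fourier_coeff D n = 0"
  shows "D t = 0"
proof -
  have "Re (D t) = 0" if "t \<in> {-pi..pi}" for t
    using Re_zero_of_fourier_coeffs_zero[OF assms that] .
  moreover have "Re (\<i> * D t) = 0" if "t \<in> {-pi..pi}" for t
  proof (rule Re_zero_of_fourier_coeffs_zero[OF _ _ _ that])
    show "continuous_on UNIV (\<lambda>t. \<i> * D t)"
      by (intro continuous_intros cont)
    have "integral {-pi..pi} (\<lambda>t. \<i> * D t * cis (- (of_int n * t)))
        = integral {-pi..pi} (\<lambda>t. \<i> * (D t * cis (- (of_int n * t))))" for n
      by (simp add: mult_ac)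
    then show "fourier_coeff (\<lambda>t. \<i> * D t) n = 0" for n
      using coeff[of n] unfolding fourier_coeff_def integral_mult_right by simp
  qed (simp add: per)
  ultimately have zero: "D t = 0" if "t \<in> {-pi..pi}" for t
    using that by (simp add: complex_eq_iff)
  obtain f where f: "\<And>t. f (cis t) = D t"
    using continuous_on_circle_lift[OF cont per] by blast
  have "D t = D (Arg (cis t))"
    unfolding f[symmetric] by (simp add: cis_Arg sgn_eq)
  also have "\<dots> = 0"
    using Arg_bounded[of "cis t"] by (intro zero) auto
  finally show ?thesis .
qed

text \<open>The series converges uniformly to a continuous periodic function with the same Fourier
  coefficients as \<open>u\<close>. The integers are enumerated by \<open>int_decode\<close>, so that the sum is an ordinary
  series.\<close>
lemma fourier_series_absolutely_convergent:
  assumes cont: "continuous_on UNIV u" and per: "\<And>t. u (t + 2 * pi) = u t"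
    and summ: "summable (\<lambda>k. norm (fourier_coeff u (int_decode k)))"
  shows "u t = (\<Sum>k. fourier_coeff u (int_decode k) * cis (of_int (int_decode k) * t))"
proof -
  define a where "a k = fourier_coeff u (int_decode k)" for k
  define S where "S N t = (\<Sum>k<N. a k * cis (of_int (int_decode k) * t))" for N t
  define V where "V t = (\<Sum>k. a k * cis (of_int (int_decode k) * t))" for t
  have summ': "summable (\<lambda>k. norm (a k))" using summ by (simp add: a_def)
  have "uniform_limit UNIV S V sequentially"
    unfolding S_def [abs_def] V_def [abs_def]
    by (rule Weierstrass_m_test[OF _ summ']) (simp add: norm_mult)
  moreover have "continuous_on UNIV (S N)" for N
    unfolding S_def [abs_def] by (intro continuous_intros)
  ultimately have contV: "continuous_on UNIV V"
    by (intro uniform_limit_theorem[OF _ \<open>uniform_limit UNIV S V sequentially\<close>]) auto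
  have lim: "(\<lambda>N. S N t) \<longlonglongrightarrow> V t" for t
    using tendsto_uniform_limitI[OF \<open>uniform_limit UNIV S V sequentially\<close>] by simp
  have bd: "norm (S N t) \<le> (\<Sum>k. norm (a k))" for N t
  proof -
    have "norm (S N t) \<le> (\<Sum>k<N. norm (a k))"
      unfolding S_def by (rule order_trans[OF norm_sum]) (simp add: norm_mult)
    also have "\<dots> \<le> (\<Sum>k. norm (a k))"
      by (rule sum_le_suminf[OF summ']) auto
    finally show ?thesis .
  qed
  have S_trig: "S N = trig (int_decode ` {..<N}) (fourier_coeff u)" for N
    unfolding S_def [abs_def] trig_def [abs_def]
    by (subst sum.reindex) (auto simp: inj_on_def a_def dest: injD[OF inj_int_decode])
  have coeffS: "fourier_coeff (S N) n = (if n \<in> int_decode ` {..<N} then fourier_coeff u n else 0)" for N n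
    unfolding S_trig by (rule fourier_coeff_trig) simp
  have contV': "continuous_on {-pi..pi} V" and contu: "continuous_on {-pi..pi} u"
    using contV cont continuous_on_subset by blast+
  have coeffV: "fourier_coeff V n = fourier_coeff u n" for n
  proof (rule LIMSEQ_unique)
    have "(\<lambda>N. integral {-pi..pi} (\<lambda>t. S N t * cis (- (of_int n * t)))) \<longlonglongrightarrow>
           integral {-pi..pi} (\<lambda>t. V t * cis (- (of_int n * t)))"
    proof (rule dominated_convergence(2)[where h = "\<lambda>_. \<Sum>k. norm (a k)"])
      show "(\<lambda>t. S N t * cis (- (of_int n * t))) integrable_on {-pi..pi}" for N
        unfolding S_trig by (intro integrable_times_cis' continuous_intros)
      show "(\<lambda>N. S N t * cis (- (of_int n * t))) \<longlonglongrightarrow> V t * cis (- (of_int n * t))" for t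
        by (rule tendsto_mult_right[OF lim])
    qed (simp_all add: norm_mult bd integrable_const_ivl)
    then show "(\<lambda>N. fourier_coeff (S N) n) \<longlonglongrightarrow> fourier_coeff V n"
      unfolding fourier_coeff_def by (rule tendsto_divide[OF _ tendsto_const]) simp
    have "\<forall>\<^sub>F N in sequentially. fourier_coeff (S N) n = fourier_coeff u n"
      using eventually_gt_at_top[of "int_encode n"]
    proof eventually_elim
      case (elim N)
      then have "n \<in> int_decode ` {..<N}"
        by (metis imageI int_encode_inverse lessThan_iff)
      then show ?case by (simp add: coeffS)
    qed
    then show "(\<lambda>N. fourier_coeff (S N) n) \<longlonglongrightarrow> fourier_coeff u n"
      by (rule tendsto_eventually)
  qed
  have "u t - V t = 0"
  proof (rule zero_of_fourier_coeffs_zero)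
    show "continuous_on UNIV (\<lambda>t. u t - V t)"
      by (intro continuous_intros cont contV)
    have "cis (of_int n * (t + 2 * pi)) = cis (of_int n * t)" for n :: int and t
      using cis_mult[of "of_int n * t" "2 * pi * of_int n"] cis_multiple_2pi[of n]
      by (simp add: algebra_simps)
    then show "u (t + 2 * pi) - V (t + 2 * pi) = u t - V t" for t
      by (simp add: per V_def)
    have "integral {-pi..pi} (\<lambda>t. (u t - V t) * cis (- (of_int n * t)))
        = integral {-pi..pi} (\<lambda>t. u t * cis (- (of_int n * t))) - integral {-pi..pi} (\<lambda>t. V t * cis (- (of_int n * t)))" for n
      unfolding left_diff_distrib by (intro integral_diff integrable_times_cis' contu contV')
    then have "fourier_coeff (\<lambda>t. u t - V t) n = fourier_coeff u n - fourier_coeff V n" for n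
      unfolding fourier_coeff_def by (simp only: diff_divide_distrib)
    then show "fourier_coeff (\<lambda>t. u t - V t) n = 0" for n
      by (simp add: coeffV)
  qed
  then show ?thesis by (simp add: V_def a_def)
qed

section \<open>The dyadic estimate\<close>

text \<open>Hoelder's inequality against the constant \<open>1\<close>: integrate Young's inequality for the product of
  \<open>u x\<close> and \<open>m powr (r - 1)\<close>, where \<open>m\<close> is the mean of \<open>u\<close>.\<close>
lemma holder_on_interval:
  fixes u :: "real \<Rightarrow> real"
  assumes "1 < r" "a < b" and u: "\<And>x. 0 \<le> u x" "u integrable_on {a..b}"
    and ur: "(\<lambda>x. u x powr r) integrable_on {a..b}"
  shows "integral {a..b} u powr r \<le> (b - a) powr (r - 1) * integral {a..b} (\<lambda>x. u x powr r)"
proof -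
  define s where "s = r / (r - 1)"
  have s: "1 < s" "1 / r + 1 / s = 1" "(r - 1) * s = r"
    using \<open>1 < r\<close> by (auto simp: s_def field_simps)
  define I where "I = integral {a..b} u"
  define J where "J = integral {a..b} (\<lambda>x. u x powr r)"
  define m where "m = I / (b - a)"
  have "I \<ge> 0" unfolding I_def by (intro integral_nonneg u)
  then have "m \<ge> 0" using \<open>a < b\<close> by (simp add: m_def)
  have I_eq: "I = (b - a) * m" using \<open>a < b\<close> by (simp add: m_def)
  have young: "u x * m powr (r - 1) \<le> (1 / r) * u x powr r + m powr r / s" for x
    using Youngs_inequality[OF \<open>1 < r\<close> s(1,2) u(1)[of x], of "m powr (r - 1)"] s(3)
    by (simp add: powr_powr)
  have "integral {a..b} (\<lambda>x. u x * m powr (r - 1)) \<le> integral {a..b} (\<lambda>x. (1 / r) * u x powr r + m powr r / s)"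
    by (intro integral_le young integrable_add integrable_on_mult_left u(2) ur integrable_on_mult_right integrable_const_ivl)
  also have "\<dots> = (1 / r) * J + (b - a) * (m powr r / s)"
    unfolding J_def using \<open>a < b\<close>
    by (subst integral_add) (auto intro!: ur integrable_on_mult_right integrable_const_ivl simp del: times_divide_eq_left)
  also have "integral {a..b} (\<lambda>x. u x * m powr (r - 1)) = I * m powr (r - 1)"
    by (simp add: I_def)
  also have "I * m powr (r - 1) = (b - a) * m powr r"
    using \<open>m \<ge> 0\<close> \<open>1 < r\<close> powr_mult_base[of m "r - 1"] by (simp add: I_eq)
  finally have "(b - a) * m powr r \<le> (1 / r) * J + (b - a) * (m powr r / s)" .
  moreover have "(b - a) * m powr r * (1 - 1 / s) = (b - a) * m powr r - (b - a) * (m powr r / s)"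
    by (simp add: right_diff_distrib)
  ultimately have "(b - a) * m powr r * (1 - 1 / s) \<le> J / r"
    by simp
  moreover have "1 - 1 / s = 1 / r"
    using s(2) by linarith
  ultimately have "(b - a) * m powr r * (1 / r) \<le> J * (1 / r)"
    by simp
  then have *: "(b - a) * m powr r \<le> J"
    by (rule mult_right_le_imp_le) (use \<open>1 < r\<close> in simp)
  have "I powr r = (b - a) powr (r - 1) * ((b - a) * m powr r)"
    unfolding I_eq using \<open>a < b\<close> \<open>m \<ge> 0\<close> powr_mult_base[of "b - a" "r - 1"] by (simp add: powr_mult mult_ac)
  also have "\<dots> \<le> (b - a) powr (r - 1) * J"
    by (intro mult_left_mono *) auto
  finally show ?thesis by (simp add: I_def J_def)
qed

lemma integral_consecutive_sum:
  fixes f :: "real \<Rightarrow> real"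
  assumes "\<And>a b. f integrable_on {a..b}" "0 \<le> h"
  shows "(\<Sum>m<M. integral {x + real m * h..x + real m * h + h} f) = integral {x..x + real M * h} f"
proof (induction M)
  case (Suc M)
  have "integral {x..x + real M * h} f + integral {x + real M * h..x + real M * h + h} f
      = integral {x..x + real M * h + h} f"
    using assms by (intro Henstock_Kurzweil_Integration.integral_combine) auto
  then show ?case using Suc by (simp add: algebra_simps)
qed simp

lemma powr_add_le:
  assumes "0 \<le> a" "0 \<le> b" "0 < (r::real)"
  shows "(a + b) powr r \<le> 2 powr r * (a powr r + b powr r)"
proof -
  have "(a + b) powr r \<le> (2 * max a b) powr r"
    using assms by (intro powr_mono2) auto
  also have "\<dots> = 2 powr r * max a b powr r"
    using assms by (simp add: powr_mult)
  also have "\<dots> \<le> 2 powr r * (a powr r + b powr r)"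
    by (intro mult_left_mono) (auto simp: max_def)
  finally show ?thesis .
qed

lemma sum_geometric_growth_le:
  fixes q :: real
  assumes "finite T" "1 < q" "\<And>j. j \<in> T \<Longrightarrow> q ^ j \<le> X" "0 \<le> X"
  shows "(\<Sum>j\<in>T. q ^ j) \<le> q / (q - 1) * X"
proof (cases "T = {}")
  case False
  define m where "m = Max T"
  have m: "m \<in> T" "T \<subseteq> {..m}"
    using assms(1) False by (auto simp: m_def)
  have "(\<Sum>j\<in>T. q ^ j) \<le> (\<Sum>j\<le>m. q ^ j)"
    using m(2) assms by (intro sum_mono2) auto
  also have "\<dots> = (q ^ Suc m - 1) / (q - 1)"
    using geometric_sum[of q "Suc m"] assms(2) by (simp add: lessThan_Suc_atMost)
  also have "\<dots> \<le> q * q ^ m / (q - 1)"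
    using assms(2) by (intro divide_right_mono) auto
  also have "\<dots> \<le> q * X / (q - 1)"
    using assms(2) assms(3)[OF m(1)] by (intro divide_right_mono mult_left_mono) auto
  finally show ?thesis by simp
qed (use assms in auto)

lemma sum_geometric_decay_le:
  fixes q :: real
  assumes "finite T" "0 < q" "q < 1" "\<And>j. j \<in> T \<Longrightarrow> q ^ j \<le> X" "0 \<le> X"
  shows "(\<Sum>j\<in>T. q ^ j) \<le> 1 / (1 - q) * X"
proof (cases "T = {}")
  case False
  define m where "m = Min T"
  define n where "n = Max T - m"
  have m: "m \<in> T" "T \<subseteq> {m..m + n}"
    using assms(1) False by (auto simp: m_def n_def)
  have "(\<Sum>j\<in>T. q ^ j) \<le> (\<Sum>j\<in>{m..m + n}. q ^ j)"
    using m(2) assms by (intro sum_mono2) auto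
  also have "\<dots> = (\<Sum>i\<le>n. q ^ (i + m))"
    using sum.shift_bounds_cl_nat_ivl[of "\<lambda>j. q ^ j" 0 m n] by (simp add: atLeast0AtMost add.commute)
  also have "\<dots> = q ^ m * (\<Sum>i<Suc n. q ^ i)"
    by (simp add: power_add sum_distrib_left sum_distrib_right mult.commute lessThan_Suc_atMost)
  also have "(\<Sum>i<Suc n. q ^ i) = (1 - q ^ Suc n) / (1 - q)"
    using assms(3) by (subst sum_gp_strict) simp
  also have "q ^ m * ((1 - q ^ Suc n) / (1 - q)) \<le> X * (1 / (1 - q))"
    using assms(2-5) assms(4)[OF m(1)] by (intro mult_mono divide_right_mono) (auto simp: power_le_one simp del: power_Suc)
  finally show ?thesis by simp
qed (use assms in auto)

lemma conjugate_exponent_pos: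
  fixes r s :: real
  assumes "1 < r" "1 / r + 1 / s = 1"
  shows "0 < 1 / s"
proof -
  have "1 / r < 1" using assms(1) by simp
  then show ?thesis using assms(2) by linarith
qed

text \<open>A function of \<open>W\<^sup>1\<^sub>r\<close> through its continuous representative \<open>G\<close>; its derivative \<open>p\<close> is known and
  periodic only up to a null set.\<close>
locale periodic_sobolev =
  fixes r s :: real and G p :: "real \<Rightarrow> complex" and N :: "real set"
  assumes r: "1 < r" "r \<le> 2" and rs: "1 / r + 1 / s = 1"
    and cont: "continuous_on UNIV G" and per: "\<And>x. G (x + 2 * pi) = G x"
    and increment: "\<And>a b. a \<le> b \<Longrightarrow> G b - G a = integral {a..b} p"
    and p_int: "\<And>a b. p absolutely_integrable_on {a..b}"
    and pr_int: "\<And>a b. (\<lambda>x. norm (p x) powr r) integrable_on {a..b}"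
    and negN: "negligible N" and p_per: "\<And>x. x \<notin> N \<Longrightarrow> p (x + 2 * pi) = p x"
begin

definition \<alpha> where "\<alpha> = integral {-pi..pi} (\<lambda>x. norm (G x) powr r)"
definition \<beta> where "\<beta> = integral {-pi..pi} (\<lambda>x. norm (p x) powr r)"
definition \<Delta> where "\<Delta> h x = G (x + h) - G x"

lemma alpha_nonneg: "0 \<le> \<alpha>"
  unfolding \<alpha>_def using r
  by (intro integral_nonneg integrable_continuous_real continuous_on_powr' continuous_intros
      continuous_on_subset[OF cont]) auto

lemma beta_nonneg: "0 \<le> \<beta>"
  unfolding \<beta>_def by (intro integral_nonneg pr_int) auto

lemma cont_shift: "continuous_on S (\<lambda>x. G (x + c))"
  by (rule continuous_on_compose2[OF cont]) (auto intro!: continuous_intros)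

lemma cont_Delta: "continuous_on S (\<Delta> h)"
  unfolding \<Delta>_def [abs_def] by (intro continuous_intros cont_shift continuous_on_subset[OF cont]) auto

lemma cont_Delta_powr: "continuous_on S (\<lambda>x. norm (\<Delta> h x) powr r)"
  using r by (intro continuous_on_powr' continuous_intros cont_Delta) auto

lemma integral_shift_periodic:
  fixes f :: "real \<Rightarrow> 'a::euclidean_space"
  assumes "continuous_on UNIV f" "\<And>x. f (x + 2 * pi) = f x" "0 \<le> c"
  shows "integral {-pi..pi} (\<lambda>x. f (x + c)) = integral {-pi..pi} f"
proof -
  have "f integrable_on {a..b}" for a b
    by (intro integrable_continuous_real continuous_on_subset[OF assms(1)]) auto
  from integral_period_shift[OF this, of "{}" c] assms(2,3)
  have "integral {-pi+c..pi+c} f = integral {-pi..pi} f" by simp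
  then show ?thesis
    using integral_shift_real_ivl[of "-pi+c" c "pi+c" f] by simp
qed

lemma Delta_powr_le:
  assumes "0 < h"
  shows "norm (\<Delta> h x) powr r \<le> h powr (r - 1) * integral {x..x+h} (\<lambda>t. norm (p t) powr r)"
proof -
  have pi: "p integrable_on {x..x+h}" "(\<lambda>t. norm (p t)) integrable_on {x..x+h}"
    using p_int[of x "x+h"] by (auto simp: absolutely_integrable_on_def)
  have "norm (\<Delta> h x) \<le> integral {x..x+h} (\<lambda>t. norm (p t))"
    unfolding \<Delta>_def using assms
    by (subst increment) (auto intro!: integral_norm_bound_integral pi)
  then have "norm (\<Delta> h x) powr r \<le> integral {x..x+h} (\<lambda>t. norm (p t)) powr r"
    using r by (intro powr_mono2) auto
  also have "\<dots> \<le> (x + h - x) powr (r - 1) * integral {x..x+h} (\<lambda>t. norm (p t) powr r)"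
    using r assms by (intro holder_on_interval pi pr_int) auto
  finally show ?thesis by simp
qed

lemma period_integral_beta:
  assumes "-pi \<le> x"
  shows "integral {x..x+2*pi} (\<lambda>t. norm (p t) powr r) = \<beta>"
proof -
  have "integral {-pi+(x+pi)..pi+(x+pi)} (\<lambda>t. norm (p t) powr r) = \<beta>"
    unfolding \<beta>_def
    by (rule integral_period_shift[OF pr_int negN]) (use p_per assms in auto)
  then show ?thesis by (simp add: algebra_simps)
qed

text \<open>A step of length \<open>h\<close> stays within one period, so the local bound is controlled by the norm of
  \<open>p\<close> over a full period.\<close>
lemma Delta_powr_sup:
  assumes "0 < h" "h \<le> 2 * pi" "-pi \<le> x"
  shows "norm (\<Delta> h x) powr r \<le> h powr (r - 1) * \<beta>"
proof -
  have "integral {x..x+h} (\<lambda>t. norm (p t) powr r) \<le> integral {x..x+2*pi} (\<lambda>t. norm (p t) powr r)"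
    using assms by (intro integral_subset_le pr_int) auto
  also have "\<dots> = \<beta>" using assms by (intro period_integral_beta)
  finally show ?thesis
    by (intro order_trans[OF Delta_powr_le[OF assms(1)]] mult_left_mono) auto
qed

lemma Delta_periodic: "\<Delta> h (x + 2 * pi) = \<Delta> h x"
  using per[of x] per[of "x + h"] by (simp add: \<Delta>_def algebra_simps)

text \<open>This is the \<open>L\<^sub>r\<close> bound of a difference by \<open>h\<close> times the derivative. When \<open>M\<close> steps of length \<open>h\<close>
  make up a period, the integral of \<open>\<bar>\<Delta>\<bar> powr r\<close> equals the average of its integrals over the \<open>M\<close>
  translates by multiples of \<open>h\<close>, and at every point the \<open>M\<close> local bounds add up to the integral
  of \<open>\<bar>p\<bar> powr r\<close> over one period. This takes the place of Fubini's theorem.\<close>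
lemma integral_Delta_powr_le_beta:
  assumes "0 < M"
  defines "h \<equiv> 2 * pi / real M"
  shows "integral {-pi..pi} (\<lambda>x. norm (\<Delta> h x) powr r) \<le> h powr r * \<beta>"
proof -
  let ?I = "integral {-pi..pi} (\<lambda>x. norm (\<Delta> h x) powr r)"
  have h: "0 < h" "real M * h = 2 * pi" using assms by auto
  have int: "(\<lambda>x. norm (\<Delta> h (x + c)) powr r) integrable_on {-pi..pi}" for c
    by (intro integrable_continuous_real continuous_on_compose2[OF cont_Delta_powr]) (auto intro!: continuous_intros)
  have "real M * ?I = (\<Sum>m<M. integral {-pi..pi} (\<lambda>x. norm (\<Delta> h (x + real m * h)) powr r))"
    using h by (simp add: integral_shift_periodic[where f = "\<lambda>x. norm (\<Delta> h x) powr r"] cont_Delta_powr Delta_periodic)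
  also have "\<dots> = integral {-pi..pi} (\<lambda>x. \<Sum>m<M. norm (\<Delta> h (x + real m * h)) powr r)"
    by (intro integral_sum[symmetric] int) auto
  also have "\<dots> \<le> integral {-pi..pi} (\<lambda>_. h powr (r - 1) * \<beta>)"
  proof (intro integral_le integrable_sum int integrable_const_ivl)
    fix x assume x: "x \<in> {-pi..pi}"
    have "(\<Sum>m<M. norm (\<Delta> h (x + real m * h)) powr r)
        \<le> (\<Sum>m<M. h powr (r - 1) * integral {x + real m * h..x + real m * h + h} (\<lambda>t. norm (p t) powr r))"
      by (intro sum_mono Delta_powr_le h)
    also have "\<dots> = h powr (r - 1) * integral {x..x + real M * h} (\<lambda>t. norm (p t) powr r)"
      using h by (simp only: sum_distrib_left[symmetric] integral_consecutive_sum[OF pr_int] less_imp_le)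
    also have "\<dots> = h powr (r - 1) * \<beta>"
      using period_integral_beta[of x] x by (simp add: h)
    finally show "(\<Sum>m<M. norm (\<Delta> h (x + real m * h)) powr r) \<le> h powr (r - 1) * \<beta>" .
  qed auto
  also have "\<dots> = real M * (h * h powr (r - 1) * \<beta>)"
    using h(2) by (simp add: mult.assoc[symmetric])
  also have "h * h powr (r - 1) = h powr r"
    using h(1) powr_mult_base[of h "r - 1"] by simp
  finally show ?thesis using \<open>0 < M\<close> by simp
qed

lemma integral_Delta_powr_le_alpha:
  assumes "0 \<le> h"
  shows "integral {-pi..pi} (\<lambda>x. norm (\<Delta> h x) powr r) \<le> 2 powr (r + 1) * \<alpha>"
proof -
  have cG: "continuous_on S (\<lambda>x. norm (G (x + c)) powr r)" for S c
    using r by (intro continuous_on_powr' continuous_intros cont_shift) auto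
  have G0: "(\<lambda>x. norm (G x) powr r) integrable_on {-pi..pi}"
    using integrable_continuous_real[OF cG[of _ 0]] by simp
  have "integral {-pi..pi} (\<lambda>x. norm (\<Delta> h x) powr r)
      \<le> integral {-pi..pi} (\<lambda>x. 2 powr r * (norm (G (x + h)) powr r + norm (G x) powr r))"
  proof (intro integral_le integrable_on_mult_right integrable_add)
    fix x
    have "norm (\<Delta> h x) powr r \<le> (norm (G (x + h)) + norm (G x)) powr r"
      unfolding \<Delta>_def using r by (intro powr_mono2 norm_triangle_ineq4) auto
    also have "\<dots> \<le> 2 powr r * (norm (G (x + h)) powr r + norm (G x) powr r)"
      using r by (intro powr_add_le) auto
    finally show "norm (\<Delta> h x) powr r \<le> 2 powr r * (norm (G (x + h)) powr r + norm (G x) powr r)" .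
  qed (auto intro!: integrable_continuous_real cont_Delta_powr cG G0)
  also have "\<dots> = 2 powr r * (integral {-pi..pi} (\<lambda>x. norm (G (x + h)) powr r) + \<alpha>)"
    unfolding \<alpha>_def by (simp add: integral_add integrable_continuous_real[OF cG] G0)
  also have "integral {-pi..pi} (\<lambda>x. norm (G (x + h)) powr r) = \<alpha>"
    unfolding \<alpha>_def
    by (rule integral_shift_periodic[where f = "\<lambda>x. norm (G x) powr r"]) (use assms cG[of _ 0] in \<open>auto simp: per\<close>)
  finally show ?thesis by (simp add: powr_add)
qed

text \<open>Write \<open>\<bar>\<Delta>\<bar>\<^sup>2\<close> as \<open>\<bar>\<Delta>\<bar> powr (2 - r) * \<bar>\<Delta>\<bar> powr r\<close> and estimate the first factor by the supremum,
  which is legitimate because its exponent \<open>2 - r\<close> is nonnegative.\<close>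
lemma integral_Delta_square_le:
  assumes "0 < h" "h \<le> 2 * pi"
  shows "integral {-pi..pi} (\<lambda>x. (norm (\<Delta> h x))\<^sup>2)
       \<le> (h powr (r - 1) * \<beta>) powr ((2 - r) / r) * integral {-pi..pi} (\<lambda>x. norm (\<Delta> h x) powr r)"
proof -
  have "integral {-pi..pi} (\<lambda>x. (norm (\<Delta> h x))\<^sup>2)
    \<le> integral {-pi..pi} (\<lambda>x. (h powr (r - 1) * \<beta>) powr ((2 - r) / r) * norm (\<Delta> h x) powr r)"
  proof (intro integral_le integrable_on_mult_right integrable_continuous_real cont_Delta_powr continuous_intros cont_Delta)
    fix x assume x: "x \<in> {-pi..pi}"
    let ?d = "norm (\<Delta> h x)"
    show "?d\<^sup>2 \<le> (h powr (r - 1) * \<beta>) powr ((2 - r) / r) * ?d powr r"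
    proof (cases "?d = 0")
      case False
      then have "?d\<^sup>2 = ?d powr (2 - r) * ?d powr r"
        by (simp add: powr_add[symmetric] flip: powr_numeral)
      also have "?d powr (2 - r) = (?d powr r) powr ((2 - r) / r)"
        using r by (simp add: powr_powr)
      also have "\<dots> \<le> (h powr (r - 1) * \<beta>) powr ((2 - r) / r)"
        using r x assms by (intro powr_mono2 Delta_powr_sup) auto
      finally show ?thesis by (simp add: mult_right_mono)
    qed simp
  qed
  then show ?thesis by simp
qed

lemma fourier_coeff_Delta:
  assumes "0 \<le> h"
  shows "fourier_coeff (\<Delta> h) n = (cis (of_int n * h) - 1) * fourier_coeff G n"
proof -
  let ?e = "\<lambda>t. cis (- (of_int n * t))"
  have c: "continuous_on {-pi..pi} G" using continuous_on_subset[OF cont] by blast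
  have "?e (t + 2 * pi) = ?e t" for t
    using cis_mult[of "- (of_int n * t)" "2 * pi * of_int (-n)"] cis_multiple_2pi[of "-n"]
    by (simp add: algebra_simps)
  then have "integral {-pi..pi} (\<lambda>t. G (t + h) * ?e (t + h)) = integral {-pi..pi} (\<lambda>t. G t * ?e t)"
    by (intro integral_shift_periodic[where f = "\<lambda>t. G t * ?e t"] continuous_intros cont assms) (simp add: per)
  moreover have "(\<lambda>t. G (t + h) * ?e t) = (\<lambda>t. cis (of_int n * h) * (G (t + h) * ?e (t + h)))"
    using cis_mult[of "of_int n * h" "- (of_int n * (t + h))" for t] by (auto simp: algebra_simps)
  ultimately have "integral {-pi..pi} (\<lambda>t. G (t + h) * ?e t)
      = cis (of_int n * h) * integral {-pi..pi} (\<lambda>t. G t * ?e t)"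
    by simp
  moreover have "integral {-pi..pi} (\<lambda>t. \<Delta> h t * ?e t)
      = integral {-pi..pi} (\<lambda>t. G (t + h) * ?e t) - integral {-pi..pi} (\<lambda>t. G t * ?e t)"
    unfolding \<Delta>_def left_diff_distrib
    by (intro integral_diff integrable_times_cis' cont_shift c)
  ultimately have "integral {-pi..pi} (\<lambda>t. \<Delta> h t * ?e t)
      = (cis (of_int n * h) - 1) * integral {-pi..pi} (\<lambda>t. G t * ?e t)"
    by (simp add: left_diff_distrib)
  then show ?thesis
    by (simp add: fourier_coeff_def)
qed

lemma norm_cis_minus_one_ge:
  assumes "pi / 2 \<le> \<bar>x\<bar>" "\<bar>x\<bar> \<le> pi"
  shows "2 \<le> (norm (cis x - 1))\<^sup>2"
proof -
  have "cos \<bar>x\<bar> \<le> cos (pi / 2)"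
    using assms by (intro cos_monotone_0_pi_le) auto
  then have "cos x \<le> 0" by simp
  moreover have "(norm (cis x - 1))\<^sup>2 = (cos x - 1)\<^sup>2 + (sin x)\<^sup>2"
    by (simp add: cmod_power2)
  moreover have "(cos x - 1)\<^sup>2 + (sin x)\<^sup>2 = 2 - 2 * cos x"
    using sin_cos_squared_add[of x] by (simp add: power2_diff)
  ultimately show ?thesis by simp
qed

text \<open>For \<open>n\<close> in the dyadic block, \<open>\<bar>n * h\<bar>\<close> lies between \<open>pi / 2\<close> and \<open>pi\<close>, so
  \<open>\<bar>cis (n * h) - 1\<bar>\<^sup>2 \<ge> 2\<close> and the coefficients of \<open>G\<close> are dominated by those of \<open>\<Delta> h\<close>.
  The block has at most \<open>2 * 2^j\<close> elements, which is the factor lost in Cauchy-Schwarz.\<close>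
lemma block_square_le:
  assumes F: "finite F" "\<And>n. n \<in> F \<Longrightarrow> 2 ^ j \<le> \<bar>n\<bar> \<and> \<bar>n\<bar> < 2 ^ Suc j"
  defines "h \<equiv> pi / 2 ^ Suc j"
  shows "(\<Sum>n\<in>F. norm (fourier_coeff G n))\<^sup>2 \<le> 2 ^ j * integral {-pi..pi} (\<lambda>x. (norm (\<Delta> h x))\<^sup>2)"
proof -
  let ?a = "\<lambda>n. norm (fourier_coeff G n)"
  let ?Q = "integral {-pi..pi} (\<lambda>x. (norm (\<Delta> h x))\<^sup>2)"
  have "h > 0" by (simp add: h_def)
  have "F \<subseteq> {2 ^ j..<2 ^ Suc j} \<union> {- (2 ^ Suc j)<..- (2 ^ j)}"
    using F(2) by (force simp: abs_if split: if_splits)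
  then have "card F \<le> card ({2 ^ j..<2 ^ Suc j} \<union> {- (2 ^ Suc j)<..- (2 ^ j)} :: int set)"
    by (intro card_mono) auto
  also have "\<dots> \<le> card {2 ^ j..<2 ^ Suc j :: int} + card {- (2 ^ Suc j)<..- (2 ^ j) :: int}"
    by (rule card_Un_le)
  also have "\<dots> = 2 * 2 ^ j"
    by (simp add: nat_power_eq)
  finally have card: "real (card F) \<le> 2 * 2 ^ j"
    by (metis of_nat_le_iff of_nat_mult of_nat_numeral of_nat_power)
  have "(\<Sum>n\<in>F. ?a n)\<^sup>2 \<le> real (card F) * (\<Sum>n\<in>F. (?a n)\<^sup>2)"
    using Cauchy_Schwarz_ineq_sum[of "\<lambda>_. 1" ?a F] by simp
  also have "\<dots> \<le> (2 * 2 ^ j) * (\<Sum>n\<in>F. (?a n)\<^sup>2)"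
    using card by (intro mult_right_mono sum_nonneg) auto
  also have "\<dots> = 2 ^ j * (\<Sum>n\<in>F. 2 * (?a n)\<^sup>2)"
    by (simp add: sum_distrib_left mult_ac)
  also have "(\<Sum>n\<in>F. 2 * (?a n)\<^sup>2) \<le> (\<Sum>n\<in>F. (norm (fourier_coeff (\<Delta> h) n))\<^sup>2)"
  proof (intro sum_mono)
    fix n assume "n \<in> F"
    have n: "real_of_int (2 ^ j) \<le> real_of_int \<bar>n\<bar>" "real_of_int \<bar>n\<bar> \<le> real_of_int (2 ^ Suc j)"
      using F(2)[OF \<open>n \<in> F\<close>] unfolding of_int_le_iff by auto
    have "2 \<le> (norm (cis (of_int n * h) - 1))\<^sup>2"
    proof (rule norm_cis_minus_one_ge)
      have "2 ^ j * h \<le> \<bar>of_int n\<bar> * h" "\<bar>of_int n\<bar> * h \<le> 2 ^ Suc j * h"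
        using n \<open>h > 0\<close> by (auto intro!: mult_right_mono)
      then show "pi / 2 \<le> \<bar>of_int n * h\<bar>" "\<bar>of_int n * h\<bar> \<le> pi"
        using \<open>h > 0\<close> by (auto simp: abs_mult h_def)
    qed
    then show "2 * (?a n)\<^sup>2 \<le> (norm (fourier_coeff (\<Delta> h) n))\<^sup>2"
      using \<open>h > 0\<close> by (simp add: fourier_coeff_Delta norm_mult power_mult_distrib mult_right_mono)
  qed
  also have "\<dots> \<le> ?Q"
  proof -
    have "2 * pi * (\<Sum>n\<in>F. (norm (fourier_coeff (\<Delta> h) n))\<^sup>2) \<le> ?Q"
      by (rule bessel_inequality[OF cont_Delta F(1)])
    moreover have "1 * (\<Sum>n\<in>F. (norm (fourier_coeff (\<Delta> h) n))\<^sup>2) \<le> 2 * pi * (\<Sum>n\<in>F. (norm (fourier_coeff (\<Delta> h) n))\<^sup>2)"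
      using pi_gt3 by (intro mult_right_mono sum_nonneg) auto
    ultimately show ?thesis by linarith
  qed
  finally show ?thesis by (simp add: mult_left_mono)
qed

text \<open>The dependence on \<open>j\<close> is isolated in a geometric ratio: a bound of the mean square of \<open>\<Delta> h\<close> by
  \<open>h powr e * Z\<^sup>2\<close> bounds the block sums by a geometric sequence that grows for \<open>e < 1\<close> and decays for \<open>e > 1\<close>.\<close>
lemma block_le:
  assumes F: "finite F" "\<And>n. n \<in> F \<Longrightarrow> 2 ^ j \<le> \<bar>n\<bar> \<and> \<bar>n\<bar> < 2 ^ Suc j"
  defines "h \<equiv> pi / 2 ^ Suc j"
  assumes Q: "integral {-pi..pi} (\<lambda>x. (norm (\<Delta> h x))\<^sup>2) \<le> h powr e * Z\<^sup>2" and "0 \<le> e" "0 \<le> Z"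
  shows "(\<Sum>n\<in>F. norm (fourier_coeff G n)) \<le> 2 powr (e / 2) * (2 powr ((1 - e) / 2)) ^ j * Z"
proof (rule power2_le_imp_le)
  have "(\<Sum>n\<in>F. norm (fourier_coeff G n))\<^sup>2 \<le> 2 ^ j * integral {-pi..pi} (\<lambda>x. (norm (\<Delta> h x))\<^sup>2)"
    unfolding h_def by (rule block_square_le[OF F])
  also have "\<dots> \<le> 2 ^ j * (h powr e * Z\<^sup>2)"
    using Q by simp
  \<comment> \<open>Here \<open>pi < 4\<close> gives \<open>h \<le> 2 / 2^j\<close>, a pure power of two.\<close>
  also have "\<dots> \<le> 2 ^ j * ((2 / 2 ^ j) powr e * Z\<^sup>2)"
    using pi_less_4 \<open>0 \<le> e\<close>
    by (intro mult_left_mono mult_right_mono powr_mono2) (auto simp: h_def field_simps)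
  also have "\<dots> = (2 powr (e / 2) * (2 powr ((1 - e) / 2)) ^ j * Z)\<^sup>2"
  proof -
    have "(2 ^ j :: real) = 2 powr real j"
      by (simp add: powr_realpow)
    moreover have "(2 powr ((1 - e) / 2)) ^ j = (2 :: real) powr (real j * ((1 - e) / 2))"
      by (simp add: powr_realpow[symmetric] powr_powr mult.commute)
    moreover have "(2 powr x)\<^sup>2 = (2::real) powr (2 * x)" for x
      by (simp add: powr_add[symmetric] power2_eq_square)
    moreover have "(2 / 2 powr real j) powr e = (2::real) powr ((1 - real j) * e)"
      by (simp add: powr_diff powr_powr[symmetric])
    ultimately show ?thesis
      by (simp add: power_mult_distrib powr_add[symmetric] mult.assoc[symmetric]) (simp add: algebra_simps)
  qed
  finally show "(\<Sum>n\<in>F. norm (fourier_coeff G n))\<^sup>2 \<le> (2 powr (e / 2) * (2 powr ((1 - e) / 2)) ^ j * Z)\<^sup>2" .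
qed (use \<open>0 \<le> Z\<close> in simp)

text \<open>Using \<open>\<integral>\<bar>\<Delta>\<bar> powr r \<le> h powr r * \<beta>\<close>, the exponent of \<open>h\<close> is \<open>1 + 2 / s > 1\<close>.\<close>
lemma block_high:
  assumes F: "finite F" "\<And>n. n \<in> F \<Longrightarrow> 2 ^ j \<le> \<bar>n\<bar> \<and> \<bar>n\<bar> < 2 ^ Suc j"
  shows "(\<Sum>n\<in>F. norm (fourier_coeff G n))
      \<le> 2 powr ((1 + 2 / s) / 2) * (2 powr (- 1 / s)) ^ j * \<beta> powr (1 / r)"
proof -
  define h where "h = pi / 2 ^ Suc j"
  have h: "0 < h" "h \<le> 2 * pi" "h = 2 * pi / real (4 * 2 ^ j)"
  proof -
    have "pi / 2 ^ Suc j \<le> pi / 1"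
      by (intro divide_left_mono one_le_power) auto
    then show "h \<le> 2 * pi"
      unfolding h_def using pi_gt_zero by linarith
  qed (auto simp: h_def)
  have e: "(r - 1) * ((2 - r) / r) + r = 1 + 2 / s"
  proof -
    have "1 / s = 1 - 1 / r" using rs by linarith
    then have "1 + 2 / s = 3 - 2 / r" by simp
    then show ?thesis using r by (simp add: field_simps)
  qed
  have "integral {-pi..pi} (\<lambda>x. (norm (\<Delta> h x))\<^sup>2)
      \<le> (h powr (r - 1) * \<beta>) powr ((2 - r) / r) * integral {-pi..pi} (\<lambda>x. norm (\<Delta> h x) powr r)"
    by (rule integral_Delta_square_le[OF h(1,2)])
  also have "\<dots> \<le> (h powr (r - 1) * \<beta>) powr ((2 - r) / r) * (h powr r * \<beta>)"
    using integral_Delta_powr_le_beta[of "4 * 2 ^ j"] unfolding h(3) by (intro mult_left_mono) auto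
  also have "\<dots> = (h powr ((r - 1) * ((2 - r) / r)) * h powr r) * (\<beta> * \<beta> powr ((2 - r) / r))"
    using beta_nonneg by (simp add: powr_mult powr_powr)
  also have "h powr ((r - 1) * ((2 - r) / r)) * h powr r = h powr (1 + 2 / s)"
    unfolding powr_add[symmetric] e ..
  also have "\<beta> * \<beta> powr ((2 - r) / r) = (\<beta> powr (1 / r))\<^sup>2"
  proof -
    have "1 + (2 - r) / r = 1 / r + 1 / r" using r by (simp add: field_simps)
    then show ?thesis
      using beta_nonneg by (simp add: powr_mult_base power2_eq_square powr_add[symmetric])
  qed
  finally have "integral {-pi..pi} (\<lambda>x. (norm (\<Delta> h x))\<^sup>2) \<le> h powr (1 + 2 / s) * (\<beta> powr (1 / r))\<^sup>2" .
  moreover have "0 < 1 / s" by (rule conjugate_exponent_pos[OF r(1) rs])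
  ultimately show ?thesis
    using block_le[OF F, of "1 + 2 / s" "\<beta> powr (1 / r)"] by (simp add: h_def)
qed

text \<open>Using \<open>\<integral>\<bar>\<Delta>\<bar> powr r \<le> 2 powr (r + 1) * \<alpha>\<close>, the exponent of \<open>h\<close> comes from the supremum bound
  alone and is less than \<open>1\<close>.\<close>
lemma block_low:
  assumes F: "finite F" "\<And>n. n \<in> F \<Longrightarrow> 2 ^ j \<le> \<bar>n\<bar> \<and> \<bar>n\<bar> < 2 ^ Suc j"
  defines "e \<equiv> (r - 1) * ((2 - r) / r)"
  shows "(\<Sum>n\<in>F. norm (fourier_coeff G n))
      \<le> 2 powr (e / 2) * (2 powr ((1 - e) / 2)) ^ j
          * (2 powr ((r + 1) / 2) * \<beta> powr ((2 - r) / (2 * r)) * \<alpha> powr (1 / 2))"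
proof -
  define h where "h = pi / 2 ^ Suc j"
  have h: "0 < h" "h \<le> 2 * pi"
  proof -
    have "pi / 2 ^ Suc j \<le> pi / 1"
      by (intro divide_left_mono one_le_power) auto
    then show "h \<le> 2 * pi"
      unfolding h_def using pi_gt_zero by linarith
  qed (auto simp: h_def)
  have sq: "(x powr y)\<^sup>2 = x powr (2 * y)" for x y :: real
    by (simp add: powr_add[symmetric] power2_eq_square)
  have sq1: "(2 powr ((r + 1) / 2))\<^sup>2 = 2 powr (r + 1)"
    unfolding sq by (rule arg_cong[where f = "(powr) 2"]) simp
  have sq2: "(\<beta> powr ((2 - r) / (2 * r)))\<^sup>2 = \<beta> powr ((2 - r) / r)"
    unfolding sq by (rule arg_cong[where f = "(powr) \<beta>"]) (use r in \<open>simp add: field_simps\<close>)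
  have sq3: "(\<alpha> powr (1 / 2))\<^sup>2 = \<alpha>"
    unfolding sq using alpha_nonneg by simp
  have "integral {-pi..pi} (\<lambda>x. (norm (\<Delta> h x))\<^sup>2)
      \<le> (h powr (r - 1) * \<beta>) powr ((2 - r) / r) * integral {-pi..pi} (\<lambda>x. norm (\<Delta> h x) powr r)"
    by (rule integral_Delta_square_le[OF h])
  also have "\<dots> \<le> (h powr (r - 1) * \<beta>) powr ((2 - r) / r) * (2 powr (r + 1) * \<alpha>)"
    using h by (intro mult_left_mono integral_Delta_powr_le_alpha) auto
  also have "\<dots> = h powr e * (2 powr ((r + 1) / 2) * \<beta> powr ((2 - r) / (2 * r)) * \<alpha> powr (1 / 2))\<^sup>2"
    unfolding power_mult_distrib sq1 sq2 sq3
    using beta_nonneg by (simp add: powr_mult powr_powr e_def mult_ac)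
  finally have "integral {-pi..pi} (\<lambda>x. (norm (\<Delta> h x))\<^sup>2) 
    \<le> h powr e * (2 powr ((r + 1) / 2) * \<beta> powr ((2 - r) / (2 * r)) * \<alpha> powr (1 / 2))\<^sup>2" .
  then show ?thesis
    using block_le[OF F, of e "2 powr ((r + 1) / 2) * \<beta> powr ((2 - r) / (2 * r)) * \<alpha> powr (1 / 2)"] r
    by (simp add: h_def e_def)
qed

end

text \<open>The two summands come from the growing and from the decaying geometric series; \<open>q / (q - 1)\<close> and
  \<open>1 / (1 - t)\<close> compare such a series with its largest term.\<close>
definition sobolev_const :: "real \<Rightarrow> real \<Rightarrow> real" where
  "sobolev_const r s =
    (let e = (r - 1) * ((2 - r) / r); q = 2 powr ((1 - e) / 2); t = 2 powr (- 1 / s)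
     in 2 powr (e / 2) * 2 powr ((r + 1) / 2) * (q / (q - 1)) + 2 powr ((1 + 2 / s) / 2) * (1 / (1 - t)))"

lemma low_exponent_bounds:
  fixes r :: real
  assumes "1 < r" "r \<le> 2"
  shows "0 \<le> (r - 1) * ((2 - r) / r)" "(r - 1) * ((2 - r) / r) < 1"
proof -
  show "0 \<le> (r - 1) * ((2 - r) / r)" using assms by simp
  have "0 < (r - 1)\<^sup>2 + 1" by (simp add: add_nonneg_pos)
  then have "(r - 1) * (2 - r) < r" by (simp add: power2_eq_square algebra_simps)
  then show "(r - 1) * ((2 - r) / r) < 1" using assms by simp
qed

lemma geometric_ratio_bounds:
  fixes r s :: real
  assumes "1 < r" "r \<le> 2" "1 / r + 1 / s = 1"
  shows "1 < 2 powr ((1 - (r - 1) * ((2 - r) / r)) / 2)" "2 powr (- 1 / s) < (1::real)"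
proof -
  have "2 powr 0 < 2 powr ((1 - (r - 1) * ((2 - r) / r)) / 2)"
    using low_exponent_bounds[OF assms(1,2)] by (intro powr_less_mono) auto
  then show "1 < 2 powr ((1 - (r - 1) * ((2 - r) / r)) / 2)" by simp
  have "- 1 / s < 0" using conjugate_exponent_pos[OF assms(1,3)] by simp
  then have "2 powr (- 1 / s) < 2 powr (0::real)" by (intro powr_less_mono) auto
  then show "2 powr (- 1 / s) < (1::real)" by simp
qed

lemma sobolev_const_pos:
  assumes "1 < r" "r \<le> 2" "1 / r + 1 / s = 1"
  shows "0 < sobolev_const r s"
  unfolding sobolev_const_def Let_def
  using geometric_ratio_bounds[OF assms] by (intro add_pos_pos mult_pos_pos divide_pos_pos) auto

context periodic_sobolev
begin

text \<open>The dyadic blocks are summed with the growing bound where \<open>2^j \<le> B / A\<close> and with the decaying bound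
  elsewhere; both geometric series are then comparable to their value at \<open>2^j = B / A\<close>, where the
  two bounds agree up to constants.\<close>
lemma sum_fourier_coeffs_le:
  assumes "finite F" "0 \<notin> F"
  shows "(\<Sum>n\<in>F. norm (fourier_coeff G n))
      \<le> sobolev_const r s * (\<alpha> powr (1 / r)) powr (1 / s) * (\<beta> powr (1 / r)) powr (1 / r)"
proof -
  define e where "e = (r - 1) * ((2 - r) / r)"
  define q where "q = 2 powr ((1 - e) / 2)"
  define t where "t = (2 :: real) powr (- 1 / s)"
  define c1 where "c1 = 2 powr (e / 2) * 2 powr ((r + 1) / 2)"
  define c2 where "c2 = (2 :: real) powr ((1 + 2 / s) / 2)"
  define P where "P = \<beta> powr ((2 - r) / (2 * r)) * \<alpha> powr (1 / 2)"
  define A where "A = \<alpha> powr (1 / r)"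
  define B where "B = \<beta> powr (1 / r)"
  have qt: "1 < q" "t < 1" "0 < t"
    using geometric_ratio_bounds[OF r rs] by (auto simp: q_def t_def e_def)
  have "\<exists>j. 2 ^ j \<le> nat \<bar>n\<bar> \<and> nat \<bar>n\<bar> < 2 ^ (j + 1)" if "n \<noteq> 0" for n :: int
    by (rule ex_power_ivl1) (use that in auto)
  then obtain jj where jj: "\<And>n. n \<noteq> 0 \<Longrightarrow> 2 ^ jj n \<le> nat \<bar>n\<bar> \<and> nat \<bar>n\<bar> < 2 ^ (jj n + 1)"
    by metis
  have jj': "2 ^ jj n \<le> \<bar>n\<bar> \<and> \<bar>n\<bar> < 2 ^ Suc (jj n)" if "n \<noteq> 0" for n :: int
    using jj[OF that] by (auto simp: nat_less_iff le_nat_iff)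
  define T where "T = jj ` F"
  define b where "b j = (\<Sum>n\<in>{n\<in>F. jj n = j}. norm (fourier_coeff G n))" for j
  have "finite T" using assms(1) by (simp add: T_def)
  have blk: "finite {n\<in>F. jj n = j}" "n \<in> {n\<in>F. jj n = j} \<Longrightarrow> 2 ^ j \<le> \<bar>n\<bar> \<and> \<bar>n\<bar> < 2 ^ Suc j" for j n
    using assms jj'[of n] by auto
  have low: "b j \<le> c1 * P * q ^ j" for j
    unfolding b_def using block_low[OF blk, of j] by (simp add: c1_def P_def q_def e_def mult_ac)
  have high: "b j \<le> c2 * B * t ^ j" for j
    unfolding b_def using block_high[OF blk, of j] by (simp add: c2_def B_def t_def mult_ac)
  have total: "(\<Sum>n\<in>F. norm (fourier_coeff G n)) = (\<Sum>j\<in>T. b j)"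
    unfolding b_def T_def by (rule sum.group[symmetric]) (use assms in auto)
  have C: "sobolev_const r s = c1 * (q / (q - 1)) + c2 * (1 / (1 - t))"
    unfolding sobolev_const_def Let_def c1_def c2_def q_def t_def e_def ..
  have pos: "0 \<le> A" "0 \<le> B" "0 \<le> P" "0 \<le> c1" "0 \<le> c2" "0 \<le> sobolev_const r s"
    using sobolev_const_pos[OF r rs] by (auto simp: A_def B_def P_def c1_def c2_def)
  have "1 / s > 0" by (rule conjugate_exponent_pos[OF r(1) rs])
  have "(\<Sum>j\<in>T. b j) \<le> sobolev_const r s * (A powr (1 / s) * B powr (1 / r))"
  proof (cases "\<alpha> = 0 \<or> \<beta> = 0")
    case True
    then have "b j \<le> 0" for j
      using low[of j] high[of j] by (auto simp: P_def B_def)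
    then have "(\<Sum>j\<in>T. b j) \<le> 0" by (simp add: sum_nonpos)
    then show ?thesis
      using pos by (meson mult_nonneg_nonneg order_trans powr_ge_zero)
  next
    case False
    then have ab: "0 < \<alpha>" "0 < \<beta>" "0 < A" "0 < B"
      using alpha_nonneg beta_nonneg by (auto simp: A_def B_def)
    \<comment> \<open>The crossover frequency, at which the two bounds for a block balance.\<close>
    define \<rho> where "\<rho> = B / A"
    have \<rho>: "0 < \<rho>" using ab by (simp add: \<rho>_def)
    let ?T1 = "{j\<in>T. 2 ^ j \<le> \<rho>}" and ?T2 = "{j\<in>T. \<not> 2 ^ j \<le> \<rho>}"
    have pw: "(2 powr x) ^ j = (2 ^ j) powr x" for x :: real and j :: nat
      by (simp add: powr_realpow[symmetric] powr_powr mult.commute)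
    have low_sum: "(\<Sum>j\<in>?T1. q ^ j) \<le> q / (q - 1) * \<rho> powr ((1 - e) / 2)"
    proof (rule sum_geometric_growth_le)
      fix j assume "j \<in> ?T1"
      then show "q ^ j \<le> \<rho> powr ((1 - e) / 2)"
        unfolding q_def pw using low_exponent_bounds[OF r] by (intro powr_mono2) (auto simp: e_def)
    qed (use qt \<open>finite T\<close> in auto)
    have high_sum: "(\<Sum>j\<in>?T2. t ^ j) \<le> 1 / (1 - t) * \<rho> powr (- 1 / s)"
    proof (rule sum_geometric_decay_le)
      fix j assume "j \<in> ?T2"
      then show "t ^ j \<le> \<rho> powr (- 1 / s)"
        unfolding t_def pw using \<rho> \<open>1 / s > 0\<close> by (intro powr_mono2') auto
    qed (use qt \<open>finite T\<close> in auto)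
    have "(\<Sum>j\<in>T. b j) = (\<Sum>j\<in>?T1. b j) + (\<Sum>j\<in>?T2. b j)"
      using \<open>finite T\<close> by (subst sum.union_disjoint[symmetric]) (auto intro!: sum.cong)
    also have "\<dots> \<le> (\<Sum>j\<in>?T1. c1 * P * q ^ j) + (\<Sum>j\<in>?T2. c2 * B * t ^ j)"
      by (intro add_mono sum_mono low high)
    also have "\<dots> = c1 * P * (\<Sum>j\<in>?T1. q ^ j) + c2 * B * (\<Sum>j\<in>?T2. t ^ j)"
      by (simp add: sum_distrib_left)
    also have "\<dots> \<le> c1 * P * (q / (q - 1) * \<rho> powr ((1 - e) / 2)) + c2 * B * (1 / (1 - t) * \<rho> powr (- 1 / s))"
      using pos by (intro add_mono mult_left_mono low_sum high_sum) auto
    also have "\<dots> = c1 * (q / (q - 1)) * (P * \<rho> powr ((1 - e) / 2)) + c2 * (1 / (1 - t)) * (B * \<rho> powr (- 1 / s))"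
      by (simp only: mult_ac)
    also have "P * \<rho> powr ((1 - e) / 2) = A powr (1 / s) * B powr (1 / r)"
    proof -
      have s: "1 / s = 1 - 1 / r" using rs by linarith
      have "(2 - r) / (2 * r) + (1 - e) / 2 / r = 1 / r / r"
        using r by (simp add: e_def field_simps)
      moreover have "1 / 2 - (1 - e) / 2 / r = 1 / s / r"
        unfolding s using r by (simp add: e_def field_simps)
      moreover have "P * \<rho> powr ((1 - e) / 2) = \<alpha> powr (1 / 2 - (1 - e) / 2 / r) * \<beta> powr ((2 - r) / (2 * r) + (1 - e) / 2 / r)"
        using ab by (simp add: P_def \<rho>_def A_def B_def powr_divide powr_powr powr_add powr_diff mult_ac)
      ultimately show ?thesis
        by (simp add: A_def B_def powr_powr mult.commute)
    qed
    also have "B * \<rho> powr (- 1 / s) = A powr (1 / s) * B powr (1 / r)"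
    proof -
      have "\<rho> powr (- (1 / s)) = A powr (1 / s) / B powr (1 / s)"
        using ab unfolding powr_minus by (simp add: \<rho>_def powr_divide)
      then have "B * \<rho> powr (- 1 / s) = B powr (1 - 1 / s) * A powr (1 / s)"
        using ab unfolding powr_diff by simp
      moreover have "1 - 1 / s = 1 / r" using rs by linarith
      ultimately show ?thesis by simp
    qed
    finally show ?thesis unfolding C by (simp add: distrib_right)
  qed
  then show ?thesis
    unfolding total A_def B_def by (simp add: mult.assoc)
qed

end

section \<open>Uniqueness of the Fourier transform\<close>

lemma cts_zero_of_AE_zero:
  fixes f :: "real \<Rightarrow> complex"
  assumes "continuous_on UNIV f" "negligible N" "\<And>x. x \<notin> N \<Longrightarrow> f x = 0"
  shows "f x = 0"
proof -
  have "open {x. f x \<noteq> 0}"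
    using assms(1) by (intro open_Collect_neq) (auto intro: continuous_intros)
  moreover have "negligible {x. f x \<noteq> 0}"
    by (rule negligible_subset[OF assms(2)]) (use assms(3) in auto)
  ultimately have "{x. f x \<noteq> 0} = {}"
    using open_not_negligible by blast
  then show ?thesis by blast
qed

lemma integrable_fourier_kernel:
  assumes "integrable lebesgue f"
  shows "integrable lebesgue (\<lambda>x. exp (\<i> * of_real (k * x)) * f x)"
proof (rule Bochner_Integration.integrable_bound[OF assms])
  have "(\<lambda>x. exp (\<i> * complex_of_real (k * x))) \<in> borel_measurable lborel"
    by measurable
  then have "(\<lambda>x. exp (\<i> * complex_of_real (k * x))) \<in> borel_measurable lebesgue"
    by (rule measurable_completion)
  then show "(\<lambda>x. exp (\<i> * of_real (k * x)) * f x) \<in> borel_measurable lebesgue"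
    by (rule borel_measurable_times[OF _ borel_measurable_integrable[OF assms]])
qed (simp add: norm_mult)

lemma continuous_on_fourier:
  assumes f: "integrable lebesgue f"
  shows "continuous_on UNIV (fourier f)"
proof -
  have "isCont (fourier f) k" for k
    unfolding continuous_at_sequentially comp_def
  proof (intro allI impI)
    fix X :: "nat \<Rightarrow> real" assume X: "X \<longlonglongrightarrow> k"
    show "(\<lambda>n. fourier f (X n)) \<longlonglongrightarrow> fourier f k"
      unfolding fourier_def
    proof (rule integral_dominated_convergence[where w = "\<lambda>x. norm (f x)"])
      show "AE x in lebesgue. (\<lambda>n. exp (\<i> * of_real (X n * x)) * f x) \<longlonglongrightarrow> exp (\<i> * of_real (k * x)) * f x"
        by (intro AE_I2 tendsto_intros X)
    qed (use f integrable_fourier_kernel[OF f] in \<open>auto simp: norm_mult intro: borel_measurable_integrable\<close>)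
  qed
  then show ?thesis by (simp add: continuous_on_eq_continuous_at)
qed

text \<open>The positive and the negative part of \<open>u\<close> have the same transform, in particular the same
  integral. Divided by it they are densities of probability measures with equal characteristic
  functions, hence equal almost everywhere by Levy's theorem.\<close>
lemma real_fourier_unique:
  fixes u :: "real \<Rightarrow> real"
  assumes u: "integrable lebesgue u"
    and zero: "\<And>k. fourier (\<lambda>x. of_real (u x)) k = 0"
  shows "AE x in lebesgue. u x = 0"
proof -
  \<comment> \<open>Characteristic functions belong to Borel measures, so a Borel version of \<open>u\<close> is needed.\<close>
  obtain u' where u'[measurable]: "u' \<in> borel_measurable lborel" and ae: "AE x in lborel. u x = u' x"
    using completion_ex_borel_measurable_real[of u lborel] borel_measurable_integrable[OF u] by blast
  have ae': "AE x in lebesgue. u x = u' x"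
    using ae by (rule AE_completion)
  have int': "integrable lborel u'"
  proof -
    have "integrable lebesgue u'"
      using u ae' measurable_completion[OF u'] by (subst integrable_cong_AE[of u' _ u]) auto
    then show ?thesis by (simp add: integrable_completion)
  qed
  have zero': "(LINT x|lborel. u' x *\<^sub>R iexp (k * x)) = 0" for k
  proof -
    have "(LINT x|lborel. u' x *\<^sub>R iexp (k * x)) = (LINT x|lebesgue. u' x *\<^sub>R iexp (k * x))"
      by (rule integral_completion[symmetric]) measurable
    also have "\<dots> = (LINT x|lebesgue. exp (\<i> * of_real (k * x)) * of_real (u x))"
    proof (rule integral_cong_AE)
      show "(\<lambda>x. u' x *\<^sub>R iexp (k * x)) \<in> borel_measurable lebesgue"
        by (rule measurable_completion) measurable
      have "integrable lebesgue (\<lambda>x. complex_of_real (u x))" using u by simp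
      then show "(\<lambda>x. exp (\<i> * of_real (k * x)) * of_real (u x)) \<in> borel_measurable lebesgue"
        by (intro borel_measurable_integrable integrable_fourier_kernel)
    qed (use ae' in \<open>auto simp: scaleR_conv_of_real mult.commute\<close>)
    also have "\<dots> = 0"
      using zero[of k] by (simp add: fourier_def)
    finally show ?thesis .
  qed
  define pos where "pos x = max 0 (u' x)" for x
  define neg where "neg x = max 0 (- u' x)" for x
  have [measurable]: "pos \<in> borel_measurable lborel" "neg \<in> borel_measurable lborel"
    unfolding pos_def [abs_def] neg_def [abs_def] by measurable
  have pn: "0 \<le> pos x" "0 \<le> neg x" "u' x = pos x - neg x" for x
    by (auto simp: pos_def neg_def)
  have int: "integrable lborel pos" "integrable lborel neg"
    unfolding pos_def [abs_def] neg_def [abs_def] using int' by (auto intro!: Bochner_Integration.integrable_max)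
  have intk: "integrable lborel (\<lambda>x. f x *\<^sub>R iexp (k * x))" if "integrable lborel f" for f :: "real \<Rightarrow> real" and k
    using that by (rule Bochner_Integration.integrable_bound) (use that in \<open>auto intro!: borel_measurable_scaleR borel_measurable_integrable\<close>)
  have eq: "(LINT x|lborel. pos x *\<^sub>R iexp (k * x)) = (LINT x|lborel. neg x *\<^sub>R iexp (k * x))" for k
    using zero'[of k] unfolding pn(3) scaleR_diff_left
      Bochner_Integration.integral_diff[OF intk[OF int(1)] intk[OF int(2)]] right_minus_eq .
  define m where "m = (LINT x|lborel. pos x)"
  have m': "(LINT x|lborel. neg x) = m"
  proof -
    have "complex_of_real (LINT x|lborel. neg x) = complex_of_real (LINT x|lborel. pos x)"
      using eq[of 0] unfolding integral_complex_of_real[symmetric] by (simp add: scaleR_conv_of_real)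
    then show ?thesis by (simp add: m_def)
  qed
  have "m \<ge> 0" unfolding m_def by (intro Bochner_Integration.integral_nonneg pn)
  have "AE x in lborel. u' x = 0"
  proof (cases "m = 0")
    case True
    then have "AE x in lborel. pos x = 0" "AE x in lborel. neg x = 0"
      using int pn m' by (simp_all add: m_def integral_nonneg_eq_0_iff_AE[symmetric])
    then show ?thesis by eventually_elim (simp add: pn(3))
  next
    case False
    then have "m > 0" using \<open>m \<ge> 0\<close> by simp
    define M where "M f = density lborel (\<lambda>x. ennreal (f x / m))" for f :: "real \<Rightarrow> real"
    have rd: "real_distribution (M f)" 
      if [measurable]: "f \<in> borel_measurable lborel" and f: "\<And>x. 0 \<le> f x" "integrable lborel f" "(LINT x|lborel. f x) = m" for f
    proof -
      have "emeasure (M f) (space (M f)) = (\<integral>\<^sup>+x. ennreal (f x / m) \<partial>lborel)"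
        by (simp add: M_def emeasure_density)
      also have "\<dots> = ennreal (LINT x|lborel. f x / m)"
        using f \<open>m > 0\<close> by (intro nn_integral_eq_integral) auto
      also have "\<dots> = 1" using f \<open>m > 0\<close> by simp
      finally have "prob_space (M f)" by (rule prob_spaceI)
      then show ?thesis
        by (auto simp: real_distribution_def real_distribution_axioms_def M_def)
    qed
    have char: "char (M f) k = (LINT x|lborel. f x *\<^sub>R iexp (k * x)) / m"
      if [measurable]: "f \<in> borel_measurable lborel" and f: "\<And>x. 0 \<le> f x" for f k
    proof -
      have "char (M f) k = (LINT x|lborel. (f x / m) *\<^sub>R iexp (k * x))"
        unfolding char_def M_def using f \<open>m > 0\<close> by (subst integral_density) auto
      also have "\<dots> = (LINT x|lborel. (1 / m) *\<^sub>R (f x *\<^sub>R iexp (k * x)))" by simp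
      also have "\<dots> = (1 / m) *\<^sub>R (LINT x|lborel. f x *\<^sub>R iexp (k * x))"
        by (rule integral_scaleR_right)
      finally show ?thesis by (simp add: scaleR_conv_of_real)
    qed
    have "M pos = M neg"
    proof (rule Levy_uniqueness)
      show "real_distribution (M pos)" "real_distribution (M neg)"
        using pn int m' by (auto intro!: rd simp: m_def)
      show "char (M pos) = char (M neg)"
        using char[of pos] char[of neg] pn eq by auto
    qed
    then have "AE x in lborel. ennreal (pos x / m) = ennreal (neg x / m)"
      unfolding M_def by (intro sigma_finite_measure.density_unique[OF sigma_finite_lborel]) auto
    then show ?thesis
      by eventually_elim (use pn \<open>m > 0\<close> in \<open>auto simp: ennreal_inj\<close>)
  qed
  then have "AE x in lebesgue. u' x = 0" by (rule AE_completion)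
  with ae' show ?thesis by eventually_elim simp
qed

text \<open>Transforms are continuous, so agreement almost everywhere is agreement everywhere. The transform of
  \<open>cnj z\<close> at \<open>k\<close> is the conjugate of that of \<open>z\<close> at \<open>- k\<close>, which separates the real and the imaginary
  part of the difference.\<close>
lemma fourier_unique:
  assumes v: "v \<in> L1" and w: "w \<in> L1"
    and eq: "AE k in lebesgue. fourier v k = fourier w k"
  shows "AE x in lebesgue. v x = w x"
proof -
  have vw: "integrable lebesgue v" "integrable lebesgue w"
    using v w by (auto simp: L1_def)
  define z where "z x = v x - w x" for x
  have z: "integrable lebesgue z"
    unfolding z_def using vw by simp
  have fz: "fourier z k = fourier v k - fourier w k" for k
    unfolding fourier_def z_def right_diff_distrib
    by (intro Bochner_Integration.integral_diff integrable_fourier_kernel vw)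
  obtain N where N: "negligible N" "\<And>k. k \<notin> N \<Longrightarrow> fourier v k = fourier w k"
    using eq unfolding eventually_ae_filter_negligible by blast
  have z0: "fourier z k = 0" for k
    by (rule cts_zero_of_AE_zero[OF continuous_on_fourier[OF z] N(1)]) (simp add: fz N(2))
  have zc: "fourier (\<lambda>x. cnj (z x)) k = 0" for k
  proof -
    have "fourier (\<lambda>x. cnj (z x)) k = (LINT x|lebesgue. cnj (exp (\<i> * of_real (- k * x)) * z x))"
      by (simp add: fourier_def exp_cnj)
    also have "\<dots> = cnj (fourier z (- k))"
      unfolding fourier_def by (rule Bochner_Integration.integral_cnj)
    finally show ?thesis by (simp add: z0)
  qed
  have c: "integrable lebesgue (\<lambda>x. cnj (z x))" using z by simp
  have Re0: "fourier (\<lambda>x. of_real (Re (z x))) k = 0" for k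
  proof -
    have "fourier (\<lambda>x. of_real (Re (z x))) k
       = (LINT x|lebesgue. (1 / 2) * (exp (\<i> * of_real (k * x)) * z x + exp (\<i> * of_real (k * x)) * cnj (z x)))"
      unfolding fourier_def by (intro Bochner_Integration.integral_cong refl) (simp add: complex_add_cnj distrib_left[symmetric])
    also have "\<dots> = (1 / 2) * (fourier z k + fourier (\<lambda>x. cnj (z x)) k)"
      unfolding fourier_def integral_mult_right_zero
      by (subst Bochner_Integration.integral_add) (intro integrable_fourier_kernel z c refl)+
    finally show ?thesis by (simp add: z0 zc)
  qed
  have Im0: "fourier (\<lambda>x. of_real (Im (z x))) k = 0" for k
  proof -
    have "fourier (\<lambda>x. of_real (Im (z x))) k
       = (LINT x|lebesgue. (1 / (2 * \<i>)) * (exp (\<i> * of_real (k * x)) * z x - exp (\<i> * of_real (k * x)) * cnj (z x)))"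
    proof -
      have im: "complex_of_real (Im w) = (1 / (2 * \<i>)) * (w - cnj w)" for w
        by (simp add: complex_eq_iff)
      then show ?thesis
        unfolding fourier_def
        by (intro Bochner_Integration.integral_cong refl) (simp only: im left_diff_distrib right_diff_distrib mult_ac)
    qed
    also have "\<dots> = (1 / (2 * \<i>)) * (fourier z k - fourier (\<lambda>x. cnj (z x)) k)"
      unfolding fourier_def integral_mult_right_zero
      by (subst Bochner_Integration.integral_diff) (intro integrable_fourier_kernel z c refl)+
    finally show ?thesis by (simp add: z0 zc)
  qed
  have "AE x in lebesgue. Re (z x) = 0" "AE x in lebesgue. Im (z x) = 0"
    using z by (auto intro!: real_fourier_unique Re0 Im0 integrable_Re integrable_Im)
  then show ?thesis
    by eventually_elim (simp add: z_def complex_eq_iff)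
qed

section \<open>Multipliers given by absolutely convergent exponential sums\<close>

lemma fourier_translate:
  "fourier (\<lambda>x. f (x - c)) k = cis (c * k) * fourier f k"
proof -
  have "fourier (\<lambda>x. f (x - c)) k = (LINT x|lebesgue. exp (\<i> * of_real (k * (c + x))) * f x)"
    unfolding fourier_def
    by (subst lebesgue_integral_real_affine[of 1 _ c]) auto
  also have "\<dots> = (LINT x|lebesgue. cis (c * k) * (exp (\<i> * of_real (k * x)) * f x))"
  proof (intro Bochner_Integration.integral_cong refl)
    fix x
    have "exp (\<i> * of_real (k * (c + x))) = cis (c * k) * exp (\<i> * of_real (k * x))"
      unfolding cis_conv_exp[symmetric] cis_mult by (simp add: algebra_simps)
    then show "exp (\<i> * of_real (k * (c + x))) * f x = cis (c * k) * (exp (\<i> * of_real (k * x)) * f x)"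
      by (simp only: mult.assoc)
  qed
  finally show ?thesis
    by (simp add: fourier_def)
qed

lemma L1_translate:
  assumes "f \<in> L1"
  shows "(\<lambda>x. f (x - c)) \<in> L1" "L1_norm (\<lambda>x. f (x - c)) = L1_norm f"
proof -
  show "(\<lambda>x. f (x - c)) \<in> L1"
    using lebesgue_integrable_real_affine[of f 1 "-c"] assms by (simp add: L1_def)
  show "L1_norm (\<lambda>x. f (x - c)) = L1_norm f"
    unfolding L1_norm_def using lebesgue_integral_real_affine[of 1 "\<lambda>x. norm (f x)" "-c"] by simp
qed

text \<open>The norms of the terms add up to at most \<open>(\<Sum>j. \<bar>a j\<bar>) * L1_norm f\<close>, so the series converges absolutely almost
  everywhere and may be integrated term by term.\<close>
lemma translation_series:
  fixes a :: "nat \<Rightarrow> complex" and \<nu> :: "nat \<Rightarrow> real"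
  assumes summ: "summable (\<lambda>j. norm (a j))" and f: "f \<in> L1"
  defines "v \<equiv> \<lambda>x. \<Sum>j. a j * f (x - \<nu> j)"
  shows "v \<in> L1" "\<And>k. fourier v k = (\<Sum>j. a j * cis (\<nu> j * k)) * fourier f k"
    "L1_norm v \<le> (\<Sum>j. norm (a j)) * L1_norm f"
proof -
  let ?F = "\<lambda>j x. a j * f (x - \<nu> j)"
  have tr: "integrable lebesgue (\<lambda>x. f (x - \<nu> j))" for j
    using L1_translate(1)[OF f] by (simp add: L1_def)
  have int: "integrable lebesgue (?F j)" for j
    using tr by simp
  have norms: "(LINT x|lebesgue. norm (?F j x)) = norm (a j) * L1_norm f" for j
    using L1_translate(2)[OF f, of "\<nu> j"] by (simp add: norm_mult L1_norm_def)
  have summ_int: "summable (\<lambda>j. LINT x|lebesgue. norm (?F j x))"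
    unfolding norms by (intro summable_mult2 summ)
  have ae: "AE x in lebesgue. summable (\<lambda>j. norm (?F j x))"
  proof -
    have "(\<integral>\<^sup>+x. (\<Sum>j. ennreal (norm (?F j x))) \<partial>lebesgue) = (\<Sum>j. \<integral>\<^sup>+x. ennreal (norm (?F j x)) \<partial>lebesgue)"
      using int by (intro nn_integral_suminf) (auto intro!: borel_measurable_norm borel_measurable_integrable)
    also have "\<dots> = (\<Sum>j. ennreal (LINT x|lebesgue. norm (?F j x)))"
      by (intro arg_cong[where f=suminf] ext nn_integral_eq_integral integrable_norm int) auto
    also have "\<dots> \<noteq> \<infinity>"
      using summ_int by (simp add: ennreal_suminf_neq_top)
    finally have "AE x in lebesgue. (\<Sum>j. ennreal (norm (?F j x))) \<noteq> \<infinity>"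
      using int by (intro nn_integral_PInf_AE) (auto intro!: borel_measurable_suminf_order borel_measurable_norm borel_measurable_integrable)
    then show ?thesis
      by eventually_elim (auto intro: summable_suminf_not_top)
  qed
  show "v \<in> L1"
    unfolding L1_def v_def using integrable_suminf[OF int ae summ_int] by simp
  show "fourier v k = (\<Sum>j. a j * cis (\<nu> j * k)) * fourier f k" for k
  proof -
    let ?e = "\<lambda>x. exp (\<i> * of_real (k * x))"
    have int': "integrable lebesgue (\<lambda>x. ?e x * ?F j x)" for j
      by (rule integrable_fourier_kernel[OF int])
    have "fourier v k = (LINT x|lebesgue. (\<Sum>j. ?e x * ?F j x))"
      unfolding fourier_def v_def
    proof (rule integral_cong_AE)
      show "(\<lambda>x. ?e x * (\<Sum>j. ?F j x)) \<in> borel_measurable lebesgue"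
        using \<open>v \<in> L1\<close> by (intro borel_measurable_integrable integrable_fourier_kernel) (simp add: L1_def v_def)
      show "(\<lambda>x. \<Sum>j. ?e x * ?F j x) \<in> borel_measurable lebesgue"
        by (intro borel_measurable_suminf borel_measurable_integrable int')
      show "AE x in lebesgue. ?e x * (\<Sum>j. ?F j x) = (\<Sum>j. ?e x * ?F j x)"
        using ae by eventually_elim (auto intro: suminf_mult[symmetric] summable_norm_cancel)
    qed
    also have "\<dots> = (\<Sum>j. LINT x|lebesgue. ?e x * ?F j x)"
      by (rule integral_suminf[OF int']) (use ae summ_int in \<open>simp_all add: norm_mult\<close>)
    also have "\<dots> = (\<Sum>j. a j * cis (\<nu> j * k) * fourier f k)"
    proof (intro arg_cong[where f = suminf] ext)
      fix j
      have "(LINT x|lebesgue. ?e x * ?F j x) = a j * fourier (\<lambda>x. f (x - \<nu> j)) k"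
        unfolding fourier_def by (simp add: mult.left_commute)
      then show "(LINT x|lebesgue. ?e x * ?F j x) = a j * cis (\<nu> j * k) * fourier f k"
        by (simp add: fourier_translate)
    qed
    also have "\<dots> = (\<Sum>j. a j * cis (\<nu> j * k)) * fourier f k"
      by (rule suminf_mult2[symmetric]) (rule summable_norm_cancel, simp add: norm_mult summ)
    finally show ?thesis .
  qed
  have "L1_norm v \<le> (LINT x|lebesgue. (\<Sum>j. norm (?F j x)))"
    unfolding L1_norm_def
  proof (rule integral_mono_AE)
    show "integrable lebesgue (\<lambda>x. norm (v x))"
      using \<open>v \<in> L1\<close> by (simp add: L1_def)
    show "integrable lebesgue (\<lambda>x. \<Sum>j. norm (?F j x))"
      by (rule integrable_suminf) (use int ae summ_int in auto)
    show "AE x in lebesgue. norm (v x) \<le> (\<Sum>j. norm (?F j x))"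
      using ae by eventually_elim (auto simp: v_def intro: summable_norm)
  qed
  also have "\<dots> = (\<Sum>j. LINT x|lebesgue. norm (?F j x))"
    by (rule integral_suminf) (use int ae summ_int in auto)
  also have "\<dots> = (\<Sum>j. norm (a j)) * L1_norm f"
    unfolding norms by (rule suminf_mult2[symmetric, OF summ])
  finally show "L1_norm v \<le> (\<Sum>j. norm (a j)) * L1_norm f" .
qed

text \<open>Uniqueness of the transform identifies whatever function \<open>multiplier_op\<close> selects with the
  translation series, whose norm is known.\<close>
lemma exponential_sum_multiplier:
  fixes a :: "nat \<Rightarrow> complex" and \<nu> :: "nat \<Rightarrow> real"
  assumes summ: "summable (\<lambda>j. norm (a j))"
    and meas: "\<psi> \<in> borel_measurable lebesgue"
    and ae: "AE k in lebesgue. \<psi> k = (\<Sum>j. a j * cis (\<nu> j * k))"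
  shows "L1_multiplier \<psi>" "L1_opnorm (multiplier_op \<psi>) \<le> ennreal (\<Sum>j. norm (a j))"
proof -
  have rel: "multiplier_rel \<psi> f (\<lambda>x. \<Sum>j. a j * f (x - \<nu> j))" if "f \<in> L1" for f
    unfolding multiplier_rel_def using translation_series(1,2)[OF summ that, of \<nu>] ae
    by (auto elim!: eventually_mono)
  then show "L1_multiplier \<psi>"
    using meas unfolding L1_multiplier_def by blast
  show "L1_opnorm (multiplier_op \<psi>) \<le> ennreal (\<Sum>j. norm (a j))"
    unfolding L1_opnorm_def
  proof (rule SUP_least)
    fix f assume "f \<in> {f \<in> L1. L1_norm f \<le> 1}"
    then have f: "f \<in> L1" "L1_norm f \<le> 1" by auto
    define v where "v x = (\<Sum>j. a j * f (x - \<nu> j))" for x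
    define w where "w = multiplier_op \<psi> f"
    have v: "multiplier_rel \<psi> f v"
      using rel[OF f(1)] by (simp add: v_def [abs_def])
    then have w: "multiplier_rel \<psi> f w"
      using someI[of "multiplier_rel \<psi> f" v] by (simp add: w_def multiplier_op_def)
    have "AE x in lebesgue. w x = v x"
    proof (rule fourier_unique)
      show "AE k in lebesgue. fourier w k = fourier v k"
        using v w unfolding multiplier_rel_def by (auto elim: eventually_elim2)
    qed (use v w in \<open>auto simp: multiplier_rel_def\<close>)
    then have "L1_norm w = L1_norm v"
      unfolding L1_norm_def using v w
      by (intro integral_cong_AE) (auto simp: multiplier_rel_def L1_def intro: borel_measurable_integrable)
    also have "\<dots> \<le> (\<Sum>j. norm (a j)) * L1_norm f"
      unfolding v_def [abs_def] by (rule translation_series(3)[OF summ f(1)])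
    also have "\<dots> \<le> (\<Sum>j. norm (a j)) * 1"
      by (intro mult_left_mono f suminf_nonneg summ) auto
    finally show "ennreal (L1_norm (multiplier_op \<psi> f)) \<le> ennreal (\<Sum>j. norm (a j))"
      by (simp add: w_def ennreal_leI)
  qed
qed

section \<open>Sobolev functions and their multipliers\<close>

lemma primitive_exists:
  fixes f :: "real \<Rightarrow> complex"
  assumes int: "\<And>a b. f integrable_on {a..b}"
  obtains J where "continuous_on UNIV J" "\<And>a b. a \<le> b \<Longrightarrow> J b - J a = integral {a..b} f"
proof
  define J where "J x = integral {0..x} f - integral {x..0} f" for x
  note comb = Henstock_Kurzweil_Integration.integral_combine[OF _ _ int]
  have J0: "J x = integral {0..x} f" if "0 \<le> x" for x
    using that by (cases "x = 0") (auto simp: J_def)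
  have J1: "J x = - integral {x..0} f" if "x \<le> 0" for x
    using that by (cases "x = 0") (auto simp: J_def)
  show incr: "J b - J a = integral {a..b} f" if "a \<le> b" for a b
  proof -
    consider "0 \<le> a" | "b \<le> 0" | "a \<le> 0" "0 \<le> b" using that by linarith
    then show ?thesis
    proof cases
      case 1
      then show ?thesis using that comb[of 0 a b] by (simp add: J0 algebra_simps)
    next
      case 2
      then show ?thesis using that comb[of a b 0] by (simp add: J1 algebra_simps)
    next
      case 3
      then show ?thesis using comb[of a 0 b] by (simp add: J0 J1 add.commute)
    qed
  qed
  have "isCont J x" for x
  proof -
    have "continuous_on {x-1..x+1} (\<lambda>y. J (x - 1) + integral {x-1..y} f)"
      by (intro continuous_intros indefinite_integral_continuous_1 int)
    moreover have "J (x - 1) + integral {x-1..y} f = J y" if "y \<in> {x-1..x+1}" for y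
      using incr[of "x - 1" y] that by (simp add: algebra_simps)
    ultimately have "continuous_on {x-1..x+1} J"
      by (rule continuous_on_eq)
    then show ?thesis
      by (rule continuous_on_interior) simp
  qed
  then show "continuous_on UNIV J"
    by (simp add: continuous_on_eq_continuous_at)
qed

lemma weak_derivative_representative:
  assumes gen: "has_generalized_derivative g g'"
  obtains G N where "continuous_on UNIV G" "negligible N" "\<And>x. x \<notin> N \<Longrightarrow> g x = G x"
    "\<And>a b. a \<le> b \<Longrightarrow> G b - G a = integral {a..b} g'"
proof -
  have int: "g' integrable_on {a..b}" for a b
    using gen locally_integrable_absolutely unfolding has_generalized_derivative_def absolutely_integrable_on_def by blast
  obtain J where J: "continuous_on UNIV J" "\<And>a b. a \<le> b \<Longrightarrow> J b - J a = integral {a..b} g'"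
    using primitive_exists[OF int] by blast
  obtain N where N: "negligible N"
    "\<And>a b. a \<le> b \<Longrightarrow> a \<notin> N \<Longrightarrow> b \<notin> N \<Longrightarrow> g b - g a = integral {a..b} g'"
    using weak_derivative_increment[OF gen] by blast
  obtain x0 where x0: "x0 \<notin> N"
    using N(1) non_negligible_UNIV by (metis UNIV_eq_I)
  show ?thesis
  proof (rule that[of "\<lambda>x. g x0 - J x0 + J x" N])
    show "continuous_on UNIV (\<lambda>x. g x0 - J x0 + J x)"
      by (intro continuous_intros J)
    show "g x = g x0 - J x0 + J x" if "x \<notin> N" for x
      using N(2)[of x x0] N(2)[of x0 x] J(2)[of x x0] J(2)[of x0 x] that x0
      by (cases "x \<le> x0") (auto simp: algebra_simps)
  qed (use N J in auto)
qed

text \<open>The continuous representatives of \<open>g\<close> belonging to \<open>g1\<close> and \<open>g2\<close> coincide, so \<open>g1 - g2\<close> has zero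
  integral over every interval. This makes the norm of the derivative independent of its choice, and
  it carries integrability from one choice to all others.\<close>
lemma weak_derivative_unique:
  assumes "has_generalized_derivative g g1" "has_generalized_derivative g g2"
  obtains N where "negligible N" "\<And>x. x \<notin> N \<Longrightarrow> g1 x = g2 x"
proof -
  obtain G1 N1 where 1: "continuous_on UNIV G1" "negligible N1" "\<And>x. x \<notin> N1 \<Longrightarrow> g x = G1 x"
    "\<And>a b. a \<le> b \<Longrightarrow> G1 b - G1 a = integral {a..b} g1"
    using weak_derivative_representative[OF assms(1)] by blast
  obtain G2 N2 where 2: "continuous_on UNIV G2" "negligible N2" "\<And>x. x \<notin> N2 \<Longrightarrow> g x = G2 x"
    "\<And>a b. a \<le> b \<Longrightarrow> G2 b - G2 a = integral {a..b} g2"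
    using weak_derivative_representative[OF assms(2)] by blast
  have "G1 x - G2 x = 0" for x
  proof (rule cts_zero_of_AE_zero)
    show "continuous_on UNIV (\<lambda>x. G1 x - G2 x)"
      by (intro continuous_intros 1(1) 2(1))
    show "negligible (N1 \<union> N2)"
      by (intro negligible_Un 1(2) 2(2))
    show "G1 x - G2 x = 0" if "x \<notin> N1 \<union> N2" for x
      using that 1(3)[of x] 2(3)[of x] by simp
  qed
  then have eq: "G1 = G2" by auto
  have int: "g1 integrable_on {a..b}" "g2 integrable_on {a..b}" for a b
    using assms locally_integrable_absolutely unfolding has_generalized_derivative_def absolutely_integrable_on_def by blast+
  have "(\<lambda>x. g1 x - g2 x) integrable_on {a..b}" for a b
    by (intro integrable_diff int)
  moreover have "integral {a..b} (\<lambda>x. g1 x - g2 x) = 0" if "a \<le> b" for a b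
    using 1(4)[OF that] 2(4)[OF that] by (simp add: integral_diff int eq)
  ultimately obtain N where "negligible N" "\<And>x. x \<notin> N \<Longrightarrow> g1 x - g2 x = 0"
    using zero_of_zero_integrals[of "\<lambda>x. g1 x - g2 x"] by blast
  then show ?thesis using that[of N] by simp
qed

lemma periodic_integrable_on:
  fixes f :: "real \<Rightarrow> real"
  assumes f: "f integrable_on {-pi..pi}" and N: "negligible N" "\<And>x. x \<notin> N \<Longrightarrow> f (x + 2 * pi) = f x"
  shows "f integrable_on {a..b}"
proof -
  have left: "f integrable_on {u - 2 * pi..v - 2 * pi}" if "f integrable_on {u..v}" for u v
    by (rule integrable_spike[OF integrable_shift_real_ivl[OF that, of "2 * pi"] N(1)]) (simp add: N(2))
  have right: "f integrable_on {u + 2 * pi..v + 2 * pi}" if "f integrable_on {u..v}" for u v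
  proof -
    have "(\<lambda>x. f (x + - (2 * pi))) integrable_on {u + 2 * pi..v + 2 * pi}"
      using integrable_shift_real_ivl[OF that, of "- (2 * pi)"] by simp
    then show ?thesis
    proof (rule integrable_spike)
      show "negligible ((+) (2 * pi) ` N)" by (rule negligible_translation[OF N(1)])
      fix x assume x: "x \<in> {u + 2 * pi..v + 2 * pi} - (+) (2 * pi) ` N"
      have "x + - (2 * pi) \<notin> N"
      proof
        assume "x + - (2 * pi) \<in> N"
        then have "2 * pi + (x + - (2 * pi)) \<in> (+) (2 * pi) ` N" by (rule imageI)
        with x show False by simp
      qed
      then show "f x = f (x + - (2 * pi))" using N(2) by fastforce
    qed
  qed
  have *: "f integrable_on {- pi - 2 * pi * real n..pi + 2 * pi * real n}" for n
  proof (induction n)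
    case (Suc n)
    let ?l = "- pi - 2 * pi * real n" and ?u = "pi + 2 * pi * real n"
    have p: "0 \<le> 2 * pi * real n" "0 < pi" by simp_all
    have "f integrable_on {?l - 2 * pi..?l}"
      by (rule integrable_subinterval_real[OF left[OF Suc]]) (use p in auto)
    then have "f integrable_on {?l - 2 * pi..?u}"
      using Suc by (intro Henstock_Kurzweil_Integration.integrable_combine[of "?l - 2 * pi" ?l ?u]) (use p in linarith)+
    moreover have "f integrable_on {?u..?u + 2 * pi}"
      by (rule integrable_subinterval_real[OF right[OF Suc]]) (use p in auto)
    ultimately have "f integrable_on {?l - 2 * pi..?u + 2 * pi}"
      by (intro Henstock_Kurzweil_Integration.integrable_combine[of "?l - 2 * pi" ?u "?u + 2 * pi"]) (use p in linarith)+
    then show ?case by (simp add: algebra_simps)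
  qed (use f in simp)
  obtain n where n: "\<bar>a\<bar> + \<bar>b\<bar> \<le> real n" using real_arch_simple by blast
  have "real n \<le> 2 * pi * real n"
    using pi_gt3 mult_right_mono[of 1 "2 * pi" "real n"] by simp
  then have "{a..b} \<subseteq> {- pi - 2 * pi * real n..pi + 2 * pi * real n}"
    using n pi_gt3 by auto
  then show ?thesis
    using integrable_subinterval_real[OF *] by blast
qed

text \<open>Periodicity passes from \<open>g\<close> to its representative by continuity, and from there to \<open>g'\<close> because
  the integrals of \<open>g'\<close> over an interval and over its translate by a period are equal increments of \<open>G\<close>.\<close>
lemma W1_per_periodic_sobolev:
  assumes rs: "1 < r" "r \<le> 2" "1 / r + 1 / s = 1"
    and g: "\<And>x. g (x + 2 * pi) = g x"
    and gen: "has_generalized_derivative g g'" and g': "g' \<in> Lr_per r"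
  obtains G N N' where "periodic_sobolev r s G g' N" "negligible N'" "\<And>x. x \<notin> N' \<Longrightarrow> g x = G x"
proof -
  have g'_int: "g' absolutely_integrable_on {a..b}" for a b
    using gen locally_integrable_absolutely unfolding has_generalized_derivative_def by blast
  then have int: "g' integrable_on {a..b}" for a b
    by (simp add: absolutely_integrable_on_def)
  obtain G N1 where G: "continuous_on UNIV G" "negligible N1" "\<And>x. x \<notin> N1 \<Longrightarrow> g x = G x"
    "\<And>a b. a \<le> b \<Longrightarrow> G b - G a = integral {a..b} g'"
    using weak_derivative_representative[OF gen] by blast
  have per: "G (x + 2 * pi) = G x" for x
  proof -
    have "G (x + 2 * pi) - G x = 0"
    proof (rule cts_zero_of_AE_zero[where N = "N1 \<union> (+) (- (2 * pi)) ` N1" and f = "\<lambda>x. G (x + 2 * pi) - G x"])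
      show "continuous_on UNIV (\<lambda>x. G (x + 2 * pi) - G x)"
        by (intro continuous_intros continuous_on_compose2[OF G(1)]) (auto intro!: continuous_intros G(1))
      show "negligible (N1 \<union> (+) (- (2 * pi)) ` N1)"
        by (intro negligible_Un negligible_translation G(2))
      fix x assume x: "x \<notin> N1 \<union> (+) (- (2 * pi)) ` N1"
      have "x + 2 * pi \<notin> N1"
      proof
        assume "x + 2 * pi \<in> N1"
        then have "- (2 * pi) + (x + 2 * pi) \<in> (+) (- (2 * pi)) ` N1" by (rule imageI)
        with x show False by simp
      qed
      then show "G (x + 2 * pi) - G x = 0"
        using x g[of x] G(3)[of x] G(3)[of "x + 2 * pi"] by simp
    qed
    then show ?thesis by simp
  qed
  have int_shift: "(\<lambda>x. g' (x + 2 * pi)) integrable_on {a..b}" for a b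
    using integrable_shift_real_ivl[OF int[of "a + 2 * pi" "b + 2 * pi"], of "2 * pi"] by simp
  obtain N where N: "negligible N" "\<And>x. x \<notin> N \<Longrightarrow> g' (x + 2 * pi) - g' x = 0"
  proof (rule zero_of_zero_integrals[of "\<lambda>x. g' (x + 2 * pi) - g' x"])
    show "(\<lambda>x. g' (x + 2 * pi) - g' x) integrable_on {a..b}" for a b
      by (intro integrable_diff int int_shift)
    fix a b :: real assume "a \<le> b"
    have "integral {a..b} (\<lambda>x. g' (x + 2 * pi)) = integral {a + 2 * pi..b + 2 * pi} g'"
      using integral_shift_real_ivl[of "a + 2 * pi" "2 * pi" "b + 2 * pi" g'] by simp
    also have "\<dots> = integral {a..b} g'"
      using G(4)[of "a + 2 * pi" "b + 2 * pi"] G(4)[of a b] \<open>a \<le> b\<close> by (simp add: per)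
    finally show "integral {a..b} (\<lambda>x. g' (x + 2 * pi) - g' x) = 0"
      by (simp add: integral_diff int int_shift)
  qed blast
  have "(\<lambda>x. norm (g' x) powr r) integrable_on {-pi..pi}"
    using g' by (intro integrable_on_lebesgue_on) (auto simp: Lr_per_def)
  then have "(\<lambda>x. norm (g' x) powr r) integrable_on {a..b}" for a b
    by (rule periodic_integrable_on[OF _ N(1)]) (use N(2) in auto)
  then have "periodic_sobolev r s G g' N"
    by unfold_locales (use rs G(1,4) per g'_int N in auto)
  then show ?thesis using that G(2,3) by blast
qed

lemma W1_per_multiplier_bound:
  assumes rs: "1 < r" "r \<le> 2" "1 / r + 1 / s = 1"
    and g: "\<And>x. g (x + 2 * pi) = g x" "g \<in> Lr_per r"
    and gen: "has_generalized_derivative g g'" and g': "g' \<in> Lr_per r"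
  shows "L1_multiplier g"
    "L1_opnorm (multiplier_op g) \<le> ennreal (norm (fourier_coeff0 g)
       + sobolev_const r s * Lr_per_norm r g powr (1 / s) * Lr_per_norm r g' powr (1 / r))"
proof -
  obtain G N N' where "periodic_sobolev r s G g' N" and N': "negligible N'" "\<And>x. x \<notin> N' \<Longrightarrow> g x = G x"
    using W1_per_periodic_sobolev[OF rs g(1) gen g'] by blast
  interpret periodic_sobolev r s G g' N by fact
  define K where "K = sobolev_const r s * Lr_per_norm r g powr (1 / s) * Lr_per_norm r g' powr (1 / r)"
  have g_int: "integrable (lebesgue_on {-pi..pi}) g"
    using gen by (simp add: has_generalized_derivative_def locally_integrable_def)
  have \<alpha>: "Lr_per_norm r g = \<alpha> powr (1 / r)"
  proof -
    have "(LINT x|lebesgue_on {-pi..pi}. norm (g x) powr r) = integral {-pi..pi} (\<lambda>x. norm (g x) powr r)"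
      using g(2) by (intro lebesgue_integral_eq_integral) (auto simp: Lr_per_def)
    also have "\<dots> = \<alpha>"
      unfolding \<alpha>_def by (rule integral_spike[OF N'(1)]) (simp add: N'(2))
    finally show ?thesis by (simp add: Lr_per_norm_def)
  qed
  have \<beta>: "Lr_per_norm r g' = \<beta> powr (1 / r)"
    unfolding Lr_per_norm_def \<beta>_def using g'
    by (subst lebesgue_integral_eq_integral) (auto simp: Lr_per_def)
  have a0: "fourier_coeff0 g = fourier_coeff G 0"
  proof -
    have "(LINT x|lebesgue_on {-pi..pi}. g x) = integral {-pi..pi} g"
      by (rule lebesgue_integral_eq_integral[OF g_int]) simp
    also have "\<dots> = integral {-pi..pi} G"
      by (rule integral_spike[OF N'(1)]) (simp add: N'(2))
    finally show ?thesis by (simp add: fourier_coeff0_def fourier_coeff_def)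
  qed
  define a where "a j = fourier_coeff G (int_decode j)" for j
  have partial: "(\<Sum>j<n. norm (a j)) \<le> norm (fourier_coeff0 g) + K" for n
  proof -
    define F where "F = int_decode ` {..<n}"
    have "(\<Sum>j<n. norm (a j)) = (\<Sum>m\<in>F. norm (fourier_coeff G m))"
      unfolding F_def a_def by (subst sum.reindex) (auto intro: inj_on_subset[OF inj_int_decode])
    also have "\<dots> \<le> (\<Sum>m\<in>insert 0 (F - {0}). norm (fourier_coeff G m))"
      by (intro sum_mono2) (auto simp: F_def)
    also have "\<dots> = norm (fourier_coeff G 0) + (\<Sum>m\<in>F - {0}. norm (fourier_coeff G m))"
      by (subst sum.insert) (auto simp: F_def)
    also have "\<dots> \<le> norm (fourier_coeff0 g) + K"
      unfolding a0 K_def \<alpha> \<beta> by (intro add_left_mono sum_fourier_coeffs_le) (auto simp: F_def)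
    finally show ?thesis .
  qed
  have summ: "summable (\<lambda>j. norm (a j))"
    by (rule bounded_imp_summable[of _ "norm (fourier_coeff0 g) + K"])
       (use partial[of "Suc n" for n] in \<open>auto simp: lessThan_Suc_atMost\<close>)
  have series: "G t = (\<Sum>j. a j * cis (of_int (int_decode j) * t))" for t
    unfolding a_def by (rule fourier_series_absolutely_convergent[OF cont per]) (use summ in \<open>simp add: a_def\<close>)
  have ae: "AE t in lebesgue. g t = G t"
    unfolding eventually_ae_filter_negligible using N' by blast
  have meas: "g \<in> borel_measurable lebesgue"
  proof (rule borel_measurable_AE)
    show "G \<in> borel_measurable lebesgue"
      using borel_measurable_continuous_onI[OF cont] by (intro measurable_completion) simp
    show "AE t in lebesgue. G t = g t" using ae by eventually_elim simp
  qed
  have ae': "AE t in lebesgue. g t = (\<Sum>j. a j * cis (of_int (int_decode j) * t))"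
    using ae unfolding series .
  show "L1_multiplier g"
    by (rule exponential_sum_multiplier(1)[OF summ meas ae'])
  have "L1_opnorm (multiplier_op g) \<le> ennreal (\<Sum>j. norm (a j))"
    by (rule exponential_sum_multiplier(2)[OF summ meas ae'])
  also have "\<dots> \<le> ennreal (norm (fourier_coeff0 g) + K)"
    by (intro ennreal_leI suminf_le_const summ partial)
  finally show "L1_opnorm (multiplier_op g) \<le> ennreal (norm (fourier_coeff0 g)
       + sobolev_const r s * Lr_per_norm r g powr (1 / s) * Lr_per_norm r g' powr (1 / r))"
    unfolding K_def .
qed

lemma Lr_per_norm_cong:
  assumes f: "f \<in> borel_measurable (lebesgue_on {-pi..pi})" and h: "h \<in> borel_measurable (lebesgue_on {-pi..pi})"
    and N: "negligible N" "\<And>x. x \<notin> N \<Longrightarrow> f x = h x"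
  shows "Lr_per_norm r f = Lr_per_norm r h"
proof -
  have "AE x in lebesgue. f x = h x"
    unfolding eventually_ae_filter_negligible using N by blast
  then have "AE x in lebesgue_on {-pi..pi}. f x = h x"
    by (subst AE_restrict_space_iff) auto
  then have "(LINT x|lebesgue_on {-pi..pi}. norm (f x) powr r) = (LINT x|lebesgue_on {-pi..pi}. norm (h x) powr r)"
    by (intro integral_cong_AE) (use f h in auto)
  then show ?thesis by (simp add: Lr_per_norm_def)
qed

theorem theorem2p4:
  fixes r s :: real
  assumes "1 < r" and "r \<le> 2" and "1 / r + 1 / s = 1"
  shows "\<exists>C>0. \<forall>g\<in>W1_per r. L1_multiplier g \<and>
           (\<forall>g'. has_generalized_derivative g g' \<longrightarrow>
              L1_opnorm (multiplier_op g)
                \<le> ennreal (norm (fourier_coeff0 g)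
                     + C * Lr_per_norm r g powr (1 / s) * Lr_per_norm r g' powr (1 / r)))"
proof (intro exI[of _ "sobolev_const r s"] conjI ballI allI impI)
  show "0 < sobolev_const r s"
    by (rule sobolev_const_pos[OF assms])
  fix g assume "g \<in> W1_per r"
  then obtain g0 where g: "\<And>x. g (x + 2 * pi) = g x" "g \<in> Lr_per r"
    and g0: "has_generalized_derivative g g0" "g0 \<in> Lr_per r"
    unfolding W1_per_def by blast
  note bound = W1_per_multiplier_bound[OF assms g g0]
  show "L1_multiplier g" by (rule bound(1))
  fix g' assume g': "has_generalized_derivative g g'"
  obtain N where N: "negligible N" "\<And>x. x \<notin> N \<Longrightarrow> g' x = g0 x"
    using weak_derivative_unique[OF g' g0(1)] by blast
  have meas: "h \<in> borel_measurable (lebesgue_on {-pi..pi})" if "has_generalized_derivative g h" for h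
    using that unfolding has_generalized_derivative_def locally_integrable_def
    by (blast intro: borel_measurable_integrable)
  have "Lr_per_norm r g' = Lr_per_norm r g0"
    by (rule Lr_per_norm_cong[OF meas[OF g'] meas[OF g0(1)] N])
  then show "L1_opnorm (multiplier_op g) \<le> ennreal (norm (fourier_coeff0 g)
      + sobolev_const r s * Lr_per_norm r g powr (1 / s) * Lr_per_norm r g' powr (1 / r))"
    using bound(2) by simp
qed

end
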